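(* Let $X$ be a bikei and let $L$ and $L'$ be marked vertex diagrams related by Yoshikawa moves. Then for every $X$-labeling of $L$ there is a unique corresponding $X$-labeling of $L'$. Here, if $L=L_0,L_1,\dots,L_n=L'$ is a sequence of diagrams in which $L_{i+1}$ is obtained from $L_i$ by a single Yoshikawa move supported in a disk $B_i$, an $X$-labeling $f'$ of $L'$ corresponds to an $X$-labeling $f$ of $L$ (along the sequence) if there are $X$-labelings $f=f_0,f_1,\dots,f_n=f'$ of $L_0,\dots,L_n$ such that for each $i$ the labelings $f_i$ and $f_{i+1}$ agree at every point of the diagram outside $B_i$.
   Context: Bikei. A bikei is a set $X$ with two binary operations $(x,y)\mapsto x^y$ and $(x,y)\mapsto x_y$ such that for all $x,y,z\in X$: (i) $x^x=x_x$; (ii) the maps $\alpha_y,\beta_y:X\to X$, $\alpha_y(x)=x_y$, $\beta_y(x)=x^y$, and $S:X\times X\to X\times X$, $S(x,y)=(y_x,x^y)$, are bijective; (iii) (exchange laws) $(x^y)^{(z^y)}=(x^z)^{(y_z)}$, $(x^y)_{(z^y)}=(x_z)^{(y_z)}$, $(x_y)_{(z_y)}=(x_z)_{(y^z)}$; (iv) $(x^y)^y=x=(x_y)_y$, $x^{(y_x)}=x^y$ and $y_{(x^y)}=y_x$. Diagrams. A marked vertex diagram is a finite plane 4-valent graph (circle components without vertices are allowed), considered up to planar isotopy, each of whose vertices is either a classical crossing (with over/under information) or a saddle crossing (marked vertex), i.e. a vertex carrying a marker that says which of its two planar smoothings is used just below the level $x_3=0$ (the "$-$" smoothing), the other one being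 used just above (the "$+$" smoothing). The semiarcs are the portions of the diagram between crossing points (classical or saddle); both the over- and the under-strand are divided at a classical crossing. A circle component without crossings is one semiarc. Labelings. An $X$-labeling assigns an element of $X$ to each semiarc so that: (a) at each classical crossing, if $x$ is the label of either under-semiarc and $y$ the label of either over-semiarc, then the other under-semiarc has label $x^y$ and the other over-semiarc has label $y_x$; (b) at each saddle crossing all four incident semiarcs have the same label. Yoshikawa moves. These are the following local moves, together with their inverses and the versions obtained by reflecting the plane, by switching all the classical crossings involved, and by exchanging the $-$ and $+$ smoothings at all the saddle crossings involved. $\Gamma_1,\Gamma_2,\Gamma_3$: the unoriented Reidemeister moves I, II, III. $\Gamma_4$: a strand passing over (or under) two edges adjacent to a saddle crossing is moved across the saddle crossing so that it passes over (respectively under) the other two edges. $\Gamma_5$: for a saddle crossing with edges NW, NE, SW, SE, a classical crossing between the NE and SE edges is replaced by a classical crossing (half twist of the same handedness) between the NW and SW edges, the marker (horizontal or vertical) being unchanged. $\Gamma_6$: a saddle crossing, with either marker, two of whose adjacent edges are joined by a loop bounding an empty disk is replaced by a simple arc. $\Gamma_7$: in a disk with six boundary points $1,\dots,6$ in cyclic order, a pair of saddle crossings joined by an edge, one having remaining edges ending at $1,2,3$ and the other having remaining edges ending at $4,5,6$, is replaced by a pair of saddle crossings joined by an edge, with remaining edges ending at $2,3,4$ and $5,6,1$ respectively (all embedded without other crossings); on both sides the markers are such that the $-$ smoothings connect $1$–$2$, $3$–$4$, $5$–$6$ and the $+$ smoothings connect $2$–$3$, $4$–$5$, $6$–$1$.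 $\Gamma_8$: let $v_1$ be a saddle crossing with edges NW, NE, SW, SE whose $-$ smoothing connects NW–NE and SW–SE, and let $v_2$ be a saddle crossing in the region to the west of $v_1$, with two edges ending at the west boundary of the disk and with its other two edges being two parallel strands running to the east boundary, the $-$ smoothing of $v_2$ connecting the two west ends to each other and the two parallel strands to each other; the diagram in which the two parallel strands pass over the NW edge and then under the NE edge is replaced by the one in which they pass over the SW edge and then under the SE edge (each diagram has four classical crossings). *)

theory Defs
  imports "HOL-Analysis.Analysis"
begin

text \<open>\<^term>\<open>up x y\<close> is the exponent operation, \<^term>\<open>lo x y\<close> the subscript operation.\<close>

locale bikei =
  fixes X :: "'a set" and up lo :: "'a \<Rightarrow> 'a \<Rightarrow> 'a"
  assumes diag: "x \<in> X \<Longrightarrow> up x x = lo x x"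
    and lo_bij: "y \<in> X \<Longrightarrow> bij_betw (\<lambda>x. lo x y) X X"
    and up_bij: "y \<in> X \<Longrightarrow> bij_betw (\<lambda>x. up x y) X X"
    and S_bij: "bij_betw (\<lambda>(x, y). (lo y x, up x y)) (X \<times> X) (X \<times> X)"
    and exchange_up_up:
      "\<lbrakk>x \<in> X; y \<in> X; z \<in> X\<rbrakk> \<Longrightarrow> up (up x y) (up z y) = up (up x z) (lo y z)"
    and exchange_up_lo:
      "\<lbrakk>x \<in> X; y \<in> X; z \<in> X\<rbrakk> \<Longrightarrow> lo (up x y) (up z y) = up (lo x z) (lo y z)"
    and exchange_lo_lo:
      "\<lbrakk>x \<in> X; y \<in> X; z \<in> X\<rbrakk> \<Longrightarrow> lo (lo x y) (lo z y) = lo (lo x z) (up y z)"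
    and up_up: "\<lbrakk>x \<in> X; y \<in> X\<rbrakk> \<Longrightarrow> up (up x y) y = x"
    and lo_lo: "\<lbrakk>x \<in> X; y \<in> X\<rbrakk> \<Longrightarrow> lo (lo x y) y = x"
    and up_lo: "\<lbrakk>x \<in> X; y \<in> X\<rbrakk> \<Longrightarrow> up x (lo y x) = up x y"
    and lo_up: "\<lbrakk>x \<in> X; y \<in> X\<rbrakk> \<Longrightarrow> lo y (up x y) = lo y x"

text \<open>
  A diagram is a subset of the plane with two kinds of vertices. The decoration of a vertex
  \<^term>\<open>v\<close> is recorded by germs at \<^term>\<open>v\<close> of subsets of the plane, the germ of \<^term>\<open>S\<close>
  being the filter \<^term>\<open>at v within S\<close>: two sets have the same germ iff they agree in a
  punctured neighbourhood of \<^term>\<open>v\<close>. At a classical crossing, \<open>over\<close> is the germ of the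
  over-strand. At a saddle crossing, \<open>below\<close> consists of the germs of the two pairs of edges
  that are joined by the \<open>-\<close> smoothing (so the \<open>+\<close> smoothing is the other planar one).
  The values of \<open>over\<close> and \<open>below\<close> elsewhere are irrelevant.
\<close>

record diagram =
  points :: "complex set"
  crossings :: "complex set"
  saddles :: "complex set"
  over :: "complex \<Rightarrow> complex filter"
  below :: "complex \<Rightarrow> complex filter set"

definition vertices :: "diagram \<Rightarrow> complex set" where
  "vertices L = crossings L \<union> saddles L"

definition star :: "complex \<Rightarrow> complex set \<Rightarrow> complex set" where
  "star c A = (\<Union>d\<in>A. closed_segment c (c + d))"

definition local_param :: "diagram \<Rightarrow> complex set \<Rightarrow> complex \<Rightarrow> (complex \<Rightarrow> complex) \<Rightarrow> bool" where
  "local_param L A p k \<longleftrightarrow>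
     (\<exists>U g. open U \<and> homeomorphism (ball 0 1) U k g \<and> k 0 = p \<and>
        points L \<inter> U = k ` (star 0 A \<inter> ball 0 1) \<and> vertices L \<inter> U \<subseteq> {p})"

definition crossing_param :: "diagram \<Rightarrow> complex \<Rightarrow> (complex \<Rightarrow> complex) \<Rightarrow> bool" where
  "crossing_param L v k \<longleftrightarrow>
     local_param L {1, \<i>, -1, -\<i>} v k \<and>
     over L v = filtermap k (at 0 within star 0 {1, -1})"

definition saddle_param :: "diagram \<Rightarrow> complex \<Rightarrow> (complex \<Rightarrow> complex) \<Rightarrow> bool" where
  "saddle_param L v k \<longleftrightarrow>
     local_param L {1, \<i>, -1, -\<i>} v k \<and>
     below L v = {filtermap k (at 0 within star 0 {\<i>, 1}),
                  filtermap k (at 0 within star 0 {-\<i>, -1})}"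

text \<open>
  A compact subset of the plane that looks like a line near every point except for finitely many
  points, near which it looks like a pair of crossing lines, is the same thing as a finite plane
  4-valent graph, possibly with circle components that contain no vertex.
\<close>

definition marked_vertex_diagram :: "diagram \<Rightarrow> bool" where
  "marked_vertex_diagram L \<longleftrightarrow>
     compact (points L) \<and>
     finite (vertices L) \<and> vertices L \<subseteq> points L \<and> crossings L \<inter> saddles L = {} \<and>
     (\<forall>p\<in>points L - vertices L. \<exists>k. local_param L {1, -1} p k) \<and>
     (\<forall>v\<in>crossings L. \<exists>k. crossing_param L v k) \<and>
     (\<forall>v\<in>saddles L. \<exists>k. saddle_param L v k)"

definition semiarcs :: "diagram \<Rightarrow> complex set set" where
  "semiarcs L = components (points L - vertices L)"

definition label :: "diagram \<Rightarrow> (complex set \<Rightarrow> 'a) \<Rightarrow> complex \<Rightarrow> 'a" where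
  "label L f p = f (connected_component_set (points L - vertices L) p)"

text \<open>
  For a parametrization \<^term>\<open>k\<close> of a neighbourhood of a vertex, the four ends of semiarcs at the
  vertex contain the points \<^term>\<open>k (d / 2)\<close> with \<^term>\<open>d \<in> {1, \<i>, -1, -\<i>}\<close>; for a classical
  crossing the over-semiarcs are those with \<^term>\<open>d \<in> {1, -1}\<close>.
\<close>

definition labeling ::
  "'a set \<Rightarrow> ('a \<Rightarrow> 'a \<Rightarrow> 'a) \<Rightarrow> ('a \<Rightarrow> 'a \<Rightarrow> 'a) \<Rightarrow> diagram \<Rightarrow> (complex set \<Rightarrow> 'a) \<Rightarrow> bool" where
  "labeling X up lo L f \<longleftrightarrow>
     f \<in> semiarcs L \<rightarrow>\<^sub>E X \<and>
     (\<forall>v\<in>crossings L. \<forall>k. crossing_param L v k \<longrightarrow>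
        (\<forall>u\<in>{\<i>, -\<i>}. \<forall>w\<in>{1, -1}.
           label L f (k (- u / 2)) = up (label L f (k (u / 2))) (label L f (k (w / 2))) \<and>
           label L f (k (- w / 2)) = lo (label L f (k (w / 2))) (label L f (k (u / 2))))) \<and>
     (\<forall>v\<in>saddles L. \<forall>k. saddle_param L v k \<longrightarrow>
        (\<forall>d\<in>{1, \<i>, -1, -\<i>}. \<forall>d'\<in>{1, \<i>, -1, -\<i>}.
           label L f (k (d / 2)) = label L f (k (d' / 2))))"

text \<open>
  The two sides of a local move are drawn as rectangular arrays of square tiles (first row at the
  north). \<open>Em\<close> is the empty tile; \<open>WE\<close>, \<open>NS\<close>, \<open>NE\<close>, \<open>NW\<close>, \<open>SE\<close>, \<open>SW\<close> are arcs joining the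
  midpoints of the named sides; \<open>XH\<close> and \<open>XV\<close> are classical crossings in which the horizontal,
  respectively the vertical, strand is the over-strand; \<open>ME\<close> and \<open>MW\<close> are saddle crossings whose
  \<open>-\<close> smoothing joins N to E (and S to W), respectively N to W (and S to E).
\<close>

datatype tile = Em | WE | NS | NE | NW | SE | SW | XH | XV | ME | MW

type_synonym mosaic = "tile list list"

fun arms :: "tile \<Rightarrow> complex set" where
  "arms Em = {}"
| "arms WE = {-1, 1}"
| "arms NS = {\<i>, -\<i>}"
| "arms NE = {\<i>, 1}"
| "arms NW = {\<i>, -1}"
| "arms SE = {-\<i>, 1}"
| "arms SW = {-\<i>, -1}"
| "arms XH = {1, \<i>, -1, -\<i>}"
| "arms XV = {1, \<i>, -1, -\<i>}"
| "arms ME = {1, \<i>, -1, -\<i>}"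
| "arms MW = {1, \<i>, -1, -\<i>}"

definition centre :: "nat \<Rightarrow> nat \<Rightarrow> complex" where
  "centre i j = Complex (2 * real j) (- 2 * real i)"

definition rectangle :: "mosaic \<Rightarrow> complex set" where
  "rectangle T =
     cbox (Complex (-1) (1 - 2 * real (length T))) (Complex (2 * real (length (hd T)) - 1) 1)"

definition tile_centres :: "mosaic \<Rightarrow> tile set \<Rightarrow> complex set" where
  "tile_centres T K = {centre i j | i j. i < length T \<and> j < length (T ! i) \<and> T ! i ! j \<in> K}"

definition mosaic_points :: "mosaic \<Rightarrow> complex set" where
  "mosaic_points T = (\<Union>i<length T. \<Union>j<length (T ! i). star (centre i j) (arms (T ! i ! j)))"

fun switch :: "tile \<Rightarrow> tile" where
  "switch XH = XV" | "switch XV = XH" | "switch t = t"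

fun exchange :: "tile \<Rightarrow> tile" where
  "exchange ME = MW" | "exchange MW = ME" | "exchange t = t"

text \<open>
  A saddle or crossing with edges NW, NE, SE, SW is drawn here rotated by 45 degrees, with edges
  N, E, S, W in this order. Rotated and reflected versions of the moves are obtained from
  the freedom of choosing the homeomorphism in \<open>yoshikawa_move\<close> below, which may reverse
  the orientation.
\<close>

inductive yoshikawa :: "mosaic \<Rightarrow> mosaic \<Rightarrow> bool" where
  Gamma1: "yoshikawa
    [[SE, SW],
     [XH, NW]]
    [[Em, Em],
     [SW, Em]]"
| Gamma2: "yoshikawa
    [[NE, XH, SW],
     [SE, XH, NW]]
    [[NS, NS, Em],
     [NS, NS, Em]]"
| Gamma3: "yoshikawa
    [[WE, XH, SW],
     [WE, XV, XV],
     [Em, NS, NS]]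
    [[SW, NS, Em],
     [XV, XV, WE],
     [NE, XH, SW]]"
| Gamma4: "yoshikawa
    [[WE, XH, SW],
     [WE, ME, XV],
     [Em, NS, NS]]
    [[SW, NS, Em],
     [XV, ME, WE],
     [NE, XH, SW]]"
| Gamma5: "yoshikawa
    [[ME, SW],
     [NE, XH]]
    [[XH, SW],
     [NE, ME]]"
| Gamma6: "yoshikawa
    [[SE, SW],
     [ME, NW]]
    [[Em, Em],
     [SW, Em]]"
| Gamma7: "yoshikawa
    [[SE, NW, NS],
     [ME, WE, MW],
     [NS, SE, NW]]
    [[SE, ME, NW],
     [NW, NS, SE],
     [SE, MW, NW]]"
| Gamma8: "yoshikawa
    [[MW, WE, XH, WE, SW],
     [NE, WE, XH, SW, NS],
     [WE, WE, ME, XH, XH],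
     [Em, Em, NS, NS, NS],
     [Em, Em, NS, NS, NS]]
    [[MW, SW, NS, Em, Em],
     [NS, NS, NS, Em, Em],
     [XV, XV, ME, WE, WE],
     [NS, NE, XV, WE, SW],
     [NE, WE, XV, SW, NS]]"
| inverse: "yoshikawa T T' \<Longrightarrow> yoshikawa T' T"
| switched: "yoshikawa T T' \<Longrightarrow> yoshikawa (map (map switch) T) (map (map switch) T')"
| exchanged: "yoshikawa T T' \<Longrightarrow> yoshikawa (map (map exchange) T) (map (map exchange) T')"

definition depicts :: "(complex \<Rightarrow> complex) \<Rightarrow> mosaic \<Rightarrow> diagram \<Rightarrow> bool" where
  "depicts h T L \<longleftrightarrow>
     points L \<inter> h ` rectangle T = h ` mosaic_points T \<and>
     crossings L \<inter> h ` rectangle T = h ` tile_centres T {XH, XV} \<and>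
     saddles L \<inter> h ` rectangle T = h ` tile_centres T {ME, MW} \<and>
     (\<forall>c\<in>tile_centres T {XH}. over L (h c) = filtermap h (at c within star c {1, -1})) \<and>
     (\<forall>c\<in>tile_centres T {XV}. over L (h c) = filtermap h (at c within star c {\<i>, -\<i>})) \<and>
     (\<forall>c\<in>tile_centres T {ME}. below L (h c) =
        {filtermap h (at c within star c {\<i>, 1}), filtermap h (at c within star c {-\<i>, -1})}) \<and>
     (\<forall>c\<in>tile_centres T {MW}. below L (h c) =
        {filtermap h (at c within star c {\<i>, -1}), filtermap h (at c within star c {-\<i>, 1})})"

definition same_outside :: "complex set \<Rightarrow> diagram \<Rightarrow> diagram \<Rightarrow> bool" where
  "same_outside B L L' \<longleftrightarrow>
     points L - B = points L' - B \<and>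
     crossings L - B = crossings L' - B \<and>
     saddles L - B = saddles L' - B \<and>
     (\<forall>v\<in>crossings L - B. over L v = over L' v) \<and>
     (\<forall>v\<in>saddles L - B. below L v = below L' v)"

definition yoshikawa_move :: "complex set \<Rightarrow> diagram \<Rightarrow> diagram \<Rightarrow> bool" where
  "yoshikawa_move B L L' \<longleftrightarrow>
     (\<exists>T T' h g. yoshikawa T T' \<and> homeomorphism (rectangle T) B h g \<and>
        depicts h T L \<and> depicts h T' L' \<and> same_outside B L L')"

definition planar_isotopy :: "(complex \<Rightarrow> complex) \<Rightarrow> bool" where
  "planar_isotopy \<phi> \<longleftrightarrow>
     (\<exists>H :: real \<Rightarrow> complex \<Rightarrow> complex.
        continuous_on ({0..1} \<times> UNIV) (\<lambda>(t, z). H t z) \<and>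
        (\<forall>t\<in>{0..1}. \<exists>G. homeomorphism UNIV UNIV (H t) G) \<and>
        H 0 = id \<and> H 1 = \<phi>)"

definition moved_by :: "(complex \<Rightarrow> complex) \<Rightarrow> diagram \<Rightarrow> diagram \<Rightarrow> bool" where
  "moved_by \<phi> L L' \<longleftrightarrow>
     points L' = \<phi> ` points L \<and>
     crossings L' = \<phi> ` crossings L \<and>
     saddles L' = \<phi> ` saddles L \<and>
     (\<forall>v\<in>crossings L. over L' (\<phi> v) = filtermap \<phi> (over L v)) \<and>
     (\<forall>v\<in>saddles L. below L' (\<phi> v) = filtermap \<phi> ` below L v)"

text \<open>
  Diagrams are concrete subsets of the plane here. That they only matter up to planar isotopy
  is expressed by admitting planar isotopies, which carry labelings along, as further steps.
\<close>

datatype step = Move "complex set" | Isotopy "complex \<Rightarrow> complex"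

fun is_step :: "step \<Rightarrow> diagram \<Rightarrow> diagram \<Rightarrow> bool" where
  "is_step (Move B) L L' \<longleftrightarrow> yoshikawa_move B L L'"
| "is_step (Isotopy \<phi>) L L' \<longleftrightarrow> planar_isotopy \<phi> \<and> moved_by \<phi> L L'"

fun labels_agree ::
  "step \<Rightarrow> diagram \<Rightarrow> (complex set \<Rightarrow> 'a) \<Rightarrow> diagram \<Rightarrow> (complex set \<Rightarrow> 'a) \<Rightarrow> bool" where
  "labels_agree (Move B) L f L' f' \<longleftrightarrow>
     (\<forall>p\<in>points L - vertices L - B. label L' f' p = label L f p)"
| "labels_agree (Isotopy \<phi>) L f L' f' \<longleftrightarrow>
     (\<forall>p\<in>points L - vertices L. label L' f' (\<phi> p) = label L f p)"

definition yoshikawa_sequence ::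
  "nat \<Rightarrow> (nat \<Rightarrow> diagram) \<Rightarrow> (nat \<Rightarrow> step) \<Rightarrow> diagram \<Rightarrow> diagram \<Rightarrow> bool" where
  "yoshikawa_sequence n D s L L' \<longleftrightarrow>
     D 0 = L \<and> D n = L' \<and>
     (\<forall>i\<le>n. marked_vertex_diagram (D i)) \<and>
     (\<forall>i<n. is_step (s i) (D i) (D (Suc i)))"

definition corresponds ::
  "'a set \<Rightarrow> ('a \<Rightarrow> 'a \<Rightarrow> 'a) \<Rightarrow> ('a \<Rightarrow> 'a \<Rightarrow> 'a) \<Rightarrow>
   nat \<Rightarrow> (nat \<Rightarrow> diagram) \<Rightarrow> (nat \<Rightarrow> step) \<Rightarrow>
   (complex set \<Rightarrow> 'a) \<Rightarrow> (complex set \<Rightarrow> 'a) \<Rightarrow> bool" where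
  "corresponds X up lo n D s f f' \<longleftrightarrow>
     (\<exists>F. F 0 = f \<and> F n = f' \<and>
        (\<forall>i\<le>n. labeling X up lo (D i) (F i)) \<and>
        (\<forall>i<n. labels_agree (s i) (D i) (F i) (D (Suc i)) (F (Suc i))))"

end

theory Submission
  imports Defs
begin

text \<open>
  Every single step of a sequence of moves is shown to admit exactly one corresponding labeling; the
  claim for the sequence follows by induction (\<open>unique_chain\<close>). Planar isotopies simply transport
  labels (\<open>isotopy_step\<close>). A Yoshikawa move (\<open>move_step\<close>) is treated in two parts.

  The combinatorial part is \<open>yoshikawa_exchangeable\<close>. A labeling of one side of a move is a finite
  system of labels of tile sides that satisfies one condition per tile, and for each of the eight moves the
  bikei axioms say that there is exactly one labeling of the other side with the same labels at
  the rim. For \<open>\<Gamma>\<^sub>2\<close>, \<open>\<Gamma>\<^sub>4\<close> and \<open>\<Gamma>\<^sub>8\<close> this rests on \<open>up_up\<close>, \<open>lo_lo\<close>, \<open>up_lo\<close> and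
  \<open>lo_up\<close>, for \<open>\<Gamma>\<^sub>1\<close> also on \<open>diag\<close>, and for \<open>\<Gamma>\<^sub>3\<close> on the exchange laws. In \<open>\<Gamma>\<^sub>5\<close> the two strands of the crossing
  come from the same saddle and have equal labels before and after it; in \<open>\<Gamma>\<^sub>6\<close> and \<open>\<Gamma>\<^sub>7\<close> all
  labels are equal. Switching crossings amounts to passing to the dual bikei, and exchanging
  smoothings does not affect labels.

  The topological part glues the new labels in the disk \<open>B\<close> to the old ones outside. A change inside
  the disk can change the semiarcs globally, so labelings are viewed as locally constant functions on the
  points of the diagram that are not vertices (\<open>labeling_point_labeling\<close>, \<open>point_labeling_labeling\<close>).
  Three facts make the gluing work.

  First, the labeling condition refers to all parametrizations of a neighbourhood of a vertex, but it
  may be checked for a single one: any two of them differ by a permutation of the four arms that keeps the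
  over-strand, because the direction of an arm, seen in the other parametrization, is
  constant near the vertex (\<open>arm_direction\<close>, \<open>labels_match\<close>).

  Secondly, the glued function is locally constant. Invariance of domain shows that the inside and the
  outside meet only at the image of the frontier of the rectangle, where both carry the labels of the rim
  (\<open>labeling_exists\<close>).

  Thirdly, the labels outside the disk determine those at the rim, and hence the whole labeling
  (\<open>labeling_unique\<close>). Indeed, every end of the mosaic at the rim is a limit of points of the diagram
  outside the disk: otherwise the diagram, which is an open arc near this point, would end there
  (\<open>rim_end_limit_of_outside\<close>).
\<close>

section \<open>Labels at a crossing\<close>

text \<open>
  The arguments are the labels of the two under-semiarcs and of the two over-semiarcs at a crossing.
  In a bikei this relation is invariant under interchanging the two under-semiarcs and under
  interchanging the two over-semiarcs, so that one choice of names expresses the labeling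
  condition for all of them.
\<close>
definition crossing_labels ::
  "'a set \<Rightarrow> ('a \<Rightarrow> 'a \<Rightarrow> 'a) \<Rightarrow> ('a \<Rightarrow> 'a \<Rightarrow> 'a) \<Rightarrow> 'a \<Rightarrow> 'a \<Rightarrow> 'a \<Rightarrow> 'a \<Rightarrow> bool" where
  "crossing_labels X up lo u u' w w' \<longleftrightarrow> u \<in> X \<and> w \<in> X \<and> u' = up u w \<and> w' = lo w u"

context bikei begin

lemma up_closed [simp]: "x \<in> X \<Longrightarrow> y \<in> X \<Longrightarrow> up x y \<in> X"
  using up_bij[of y] by (auto simp: bij_betw_def)

lemma lo_closed [simp]: "x \<in> X \<Longrightarrow> y \<in> X \<Longrightarrow> lo x y \<in> X"
  using lo_bij[of y] by (auto simp: bij_betw_def)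

lemma crossing_labels_flip_under:
  "crossing_labels X up lo u u' w w' \<Longrightarrow> crossing_labels X up lo u' u w w'"
  by (auto simp: crossing_labels_def up_up lo_up)

lemma crossing_labels_flip_over:
  "crossing_labels X up lo u u' w w' \<Longrightarrow> crossing_labels X up lo u u' w' w"
  by (auto simp: crossing_labels_def lo_lo up_lo)

text \<open>
  Interchanging the two operations corresponds to switching all crossings of a diagram, so the
  switched version of a move is the original move for the dual bikei.
\<close>
lemma dual: "bikei X lo up"
proof
  show "bij_betw (\<lambda>(x, y). (up y x, lo x y)) (X \<times> X) (X \<times> X)"
  proof -
    have sw: "bij_betw prod.swap (X \<times> X) (X \<times> X)"
      by (auto simp: bij_betw_def inj_on_def)
    have "(\<lambda>(x, y). (up y x, lo x y)) = prod.swap \<circ> (\<lambda>(x, y). (lo y x, up x y)) \<circ> prod.swap"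
      by auto
    then show ?thesis
      using bij_betw_trans[OF bij_betw_trans[OF sw S_bij] sw] by (simp add: comp_assoc)
  qed
qed (rule diag[symmetric] up_bij lo_bij exchange_lo_lo exchange_up_lo[symmetric] exchange_up_up
      lo_lo up_up lo_up up_lo; assumption)+

text \<open>
  Reading a crossing from the opposite corner recovers the labels that one started with.
\<close>
lemma crossing_back:
  assumes "x \<in> X" "y \<in> X"
  shows "up (up x y) (lo y x) = x" "lo (lo y x) (up x y) = y"
  using crossing_labels_flip_under[OF crossing_labels_flip_over, of x "up x y" y "lo y x"] assms
  by (auto simp: crossing_labels_def)

text \<open>
  In the kink of the first Reidemeister move one over-end of the crossing is joined to one
  under-end. If \<^term>\<open>x\<close> is the label that enters, the label \<^term>\<open>y\<close> of the loop satisfies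
  \<^term>\<open>y = lo x y\<close>; it is then determined by \<^term>\<open>x\<close>, and \<^term>\<open>x\<close> leaves the kink again.
\<close>
lemma curl:
  assumes "x \<in> X" "y \<in> X" and y: "y = lo x y"
  shows "y = up x x" "up y x = x"
proof -
  have x: "x = lo y y" using lo_lo[of x y] assms by simp
  have "up x y = y" using diag[of y] up_up[of y y] x assms by simp
  then have "x = lo y x" using lo_up[of x y] x assms by simp
  then show "y = up x x" using lo_lo[of y x] diag[of x] assms by simp
  show "up y x = x" using up_lo[of y y] diag[of y] x assms by simp
qed

text \<open>
  If both strands leave a crossing with the same label, they also entered with the same label. This
  is what a crossing between two edges of one saddle requires when it is moved by \<open>\<Gamma>\<^sub>5\<close>.
\<close>
lemma equal_inputs:
  assumes "x \<in> X" "y \<in> X" "up x y = lo y x"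
  shows "x = y"
proof -
  define z where "z = up x y"
  have z: "z \<in> X" "z = lo y x" using assms by (auto simp: z_def)
  have "up x z = z" using up_lo[OF assms(1,2)] z(2) by (simp add: z_def)
  then have "x = up z z" using up_up[OF assms(1) z(1)] by simp
  moreover have "lo y z = z" using lo_up[OF assms(1,2)] z(2) by (metis z_def)
  then have "y = lo z z" using lo_lo[OF assms(2) z(1)] by simp
  ultimately show ?thesis using diag[OF z(1)] by metis
qed

text \<open>
  The exchange laws in the form that the third Reidemeister move uses: \<open>p\<close>, \<open>q\<close>, \<open>r\<close> label the
  incoming ends of the upper, the middle and the lower strand, and each equation compares an
  outgoing end before and after the move. They result from the exchange laws by substituting
  \<^term>\<open>up r p\<close> or \<^term>\<open>up q p\<close> for a variable and cancelling the double exponent.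
\<close>
lemma triangle:
  assumes "p \<in> X" "q \<in> X" "r \<in> X"
  shows "up (lo q (up r p)) (lo p r) = lo (up q p) r"
    and "up (up r (up q p)) (lo p q) = up (up r p) q"
    and "lo (lo p q) (up r (up q p)) = lo (lo p r) (lo q (up r p))"
proof -
  show "up (lo q (up r p)) (lo p r) = lo (up q p) r"
    using exchange_up_lo[of q p "up r p"] assms by (simp add: up_up lo_up)
  show *: "up (up r (up q p)) (lo p q) = up (up r p) q"
    using exchange_up_up[of r p "up q p"] assms by (simp add: up_up lo_up)
  have "lo (lo p q) (up r (up q p)) = lo (lo p q) (up (up r (up q p)) (lo p q))"
    using lo_up[of "up r (up q p)" "lo p q"] assms by simp
  then show "lo (lo p q) (up r (up q p)) = lo (lo p r) (lo q (up r p))"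
    using exchange_lo_lo[of p "up r p" q] * assms by (simp add: lo_up)
qed

end

section \<open>Labelings of mosaics\<close>

text \<open>
  Tile \<open>(i, j)\<close> occupies the integer lattice points \<open>(2i + a, 2j + b)\<close> with \<open>a, b \<le> 2\<close>, rows being
  counted southwards. The midpoint of a side shared by two tiles has the same coordinates in both,
  so a function on lattice points labels the strands of the whole mosaic and matches along
  shared sides by construction.
\<close>
abbreviation north :: "nat \<times> nat" where "north \<equiv> (0, 1)"
abbreviation east :: "nat \<times> nat" where "east \<equiv> (1, 2)"
abbreviation south :: "nat \<times> nat" where "south \<equiv> (2, 1)"
abbreviation west :: "nat \<times> nat" where "west \<equiv> (1, 0)"

fun ports :: "tile \<Rightarrow> (nat \<times> nat) set" where
  "ports Em = {}"
| "ports WE = {west, east}"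
| "ports NS = {north, south}"
| "ports NE = {north, east}"
| "ports NW = {north, west}"
| "ports SE = {south, east}"
| "ports SW = {south, west}"
| "ports t = {north, east, south, west}"

text \<open>
  Each clause computes the labels at the south and east sides from those at the north and west
  sides as far as possible. In most mosaics below, all labels are thereby expressed in terms of those
  at the northern and western rim.
\<close>
fun tile_rule ::
  "'a set \<Rightarrow> ('a \<Rightarrow> 'a \<Rightarrow> 'a) \<Rightarrow> ('a \<Rightarrow> 'a \<Rightarrow> 'a) \<Rightarrow> tile \<Rightarrow> (nat \<times> nat \<Rightarrow> 'a) \<Rightarrow> bool" where
  "tile_rule X up lo Em m \<longleftrightarrow> True"
| "tile_rule X up lo WE m \<longleftrightarrow> m west \<in> X \<and> m east = m west"
| "tile_rule X up lo NS m \<longleftrightarrow> m north \<in> X \<and> m south = m north"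
| "tile_rule X up lo NE m \<longleftrightarrow> m north \<in> X \<and> m east = m north"
| "tile_rule X up lo NW m \<longleftrightarrow> m north \<in> X \<and> m west = m north"
| "tile_rule X up lo SE m \<longleftrightarrow> m south \<in> X \<and> m east = m south"
| "tile_rule X up lo SW m \<longleftrightarrow> m west \<in> X \<and> m south = m west"
| "tile_rule X up lo XH m \<longleftrightarrow> crossing_labels X up lo (m north) (m south) (m west) (m east)"
| "tile_rule X up lo XV m \<longleftrightarrow> crossing_labels X up lo (m west) (m east) (m north) (m south)"
| "tile_rule X up lo ME m \<longleftrightarrow> m north \<in> X \<and> m west = m north \<and> m east = m north \<and> m south = m north"
| "tile_rule X up lo MW m \<longleftrightarrow> m north \<in> X \<and> m west = m north \<and> m east = m north \<and> m south = m north"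

definition mosaic_labeling ::
  "'a set \<Rightarrow> ('a \<Rightarrow> 'a \<Rightarrow> 'a) \<Rightarrow> ('a \<Rightarrow> 'a \<Rightarrow> 'a) \<Rightarrow> mosaic \<Rightarrow> (nat \<times> nat \<Rightarrow> 'a) \<Rightarrow> bool" where
  "mosaic_labeling X up lo T m \<longleftrightarrow>
     (\<forall>i<length T. \<forall>j<length (T ! i). tile_rule X up lo (T ! i ! j) (\<lambda>(a, b). m (2 * i + a, 2 * j + b)))"

definition ends :: "mosaic \<Rightarrow> (nat \<times> nat) set" where
  "ends T = (\<Union>i<length T. \<Union>j<length (T ! i). (\<lambda>(a, b). (2 * i + a, 2 * j + b)) ` ports (T ! i ! j))"

definition rim :: "mosaic \<Rightarrow> (nat \<times> nat) set" where
  "rim T = {(a, b). a = 0 \<or> a = 2 * length T \<or> b = 0 \<or> b = 2 * length (hd T)}"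

definition rectangular :: "mosaic \<Rightarrow> bool" where
  "rectangular T \<longleftrightarrow> T \<noteq> [] \<and> hd T \<noteq> [] \<and> (\<forall>r\<in>set T. length r = length (hd T))"

text \<open>
  Only the values at \<^term>\<open>ends T\<close> are constrained by \<^const>\<open>mosaic_labeling\<close>, so only
  these can be determined.
\<close>
definition rim_determines ::
  "'a set \<Rightarrow> ('a \<Rightarrow> 'a \<Rightarrow> 'a) \<Rightarrow> ('a \<Rightarrow> 'a \<Rightarrow> 'a) \<Rightarrow> mosaic \<Rightarrow> bool" where
  "rim_determines X up lo T \<longleftrightarrow>
     (\<forall>m m'. mosaic_labeling X up lo T m \<longrightarrow> mosaic_labeling X up lo T m' \<longrightarrow>
        (\<forall>e\<in>ends T \<inter> rim T. m e = m' e) \<longrightarrow> (\<forall>e\<in>ends T. m e = m' e))"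

definition extends ::
  "'a set \<Rightarrow> ('a \<Rightarrow> 'a \<Rightarrow> 'a) \<Rightarrow> ('a \<Rightarrow> 'a \<Rightarrow> 'a) \<Rightarrow> mosaic \<Rightarrow> mosaic \<Rightarrow> bool" where
  "extends X up lo T T' \<longleftrightarrow>
     (\<forall>m. mosaic_labeling X up lo T m \<longrightarrow>
        (\<exists>m'. mosaic_labeling X up lo T' m' \<and> (\<forall>e\<in>rim T. m' e = m e)))"

lemmas mosaic_simps = mosaic_labeling_def All_less_Suc2 crossing_labels_def numeral_eq_Suc

definition well_matched :: "mosaic \<Rightarrow> mosaic \<Rightarrow> bool" where
  "well_matched T T' \<longleftrightarrow> rectangular T \<and> rectangular T' \<and>
     length T = length T' \<and> length (hd T) = length (hd T') \<and> ends T \<inter> rim T = ends T' \<inter> rim T'"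

definition exchangeable ::
  "'a set \<Rightarrow> ('a \<Rightarrow> 'a \<Rightarrow> 'a) \<Rightarrow> ('a \<Rightarrow> 'a \<Rightarrow> 'a) \<Rightarrow> mosaic \<Rightarrow> mosaic \<Rightarrow> bool" where
  "exchangeable X up lo T T' \<longleftrightarrow>
     rim_determines X up lo T \<and> rim_determines X up lo T' \<and> extends X up lo T T' \<and> extends X up lo T' T"

section \<open>The moves on mosaics\<close>

context bikei begin

lemmas cancel_rules = up_up lo_lo up_lo lo_up crossing_back

text \<open>
  The loop turns back to the north-west, so its label is not computed from the rim tile by tile; it is a
  fixed point, which \<open>curl\<close> determines.
\<close>
lemma Gamma1_labeling:
  assumes "mosaic_labeling X up lo
    [[SE, SW],
     [XH, NW]] m"
  shows "m (3, 0) \<in> X" "m (4, 1) = m (3, 0)"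
    and "\<forall>k\<in>{(1, 2), (2, 1), (2, 3), (3, 2)}. m k = up (m (3, 0)) (m (3, 0))"
proof -
  have *: "m (2, 1) \<in> X" "m (3, 0) \<in> X" "m (1, 2) = m (2, 1)" "m (2, 3) = m (1, 2)"
    "m (4, 1) = up (m (2, 1)) (m (3, 0))" "m (3, 2) = lo (m (3, 0)) (m (2, 1))" "m (3, 2) = m (2, 3)"
    using assms by (simp_all add: mosaic_simps, metis)
  then have "m (2, 1) = lo (m (3, 0)) (m (2, 1))"
    by metis
  note curl[OF *(2,1) this]
  with * show "m (3, 0) \<in> X" "m (4, 1) = m (3, 0)"
    and "\<forall>k\<in>{(1, 2), (2, 1), (2, 3), (3, 2)}. m k = up (m (3, 0)) (m (3, 0))"
    by (metis insertE empty_iff)+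
qed

text \<open>
  Each of the following lemmas treats one move. Existence of the labeling of the other side is shown
  by prescribing the labels at the interior ends in terms of those at the rim; the remaining values
  are kept.
\<close>
lemma Gamma1:
  shows "well_matched
    [[SE, SW],
     [XH, NW]]
    [[Em, Em],
     [SW, Em]]"
      (is "well_matched ?T ?T'")
    and "exchangeable X up lo
    [[SE, SW],
     [XH, NW]]
    [[Em, Em],
     [SW, Em]]"
proof -
  show "well_matched ?T ?T'"
    by (simp add: well_matched_def rectangular_def ends_def rim_def lessThan_Suc
        numeral_eq_Suc insert_commute)
  have "rim_determines X up lo ?T"
    unfolding rim_determines_def
  proof (intro allI impI, goal_cases)
    case (1 m m')
    note labels = Gamma1_labeling[OF 1(1)] Gamma1_labeling[OF 1(2)]
    have rim: "m (3, 0) = m' (3, 0)" "m (4, 1) = m' (4, 1)"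
      using 1(3) by (simp_all add: ends_def rim_def lessThan_Suc numeral_eq_Suc)
    have inner0: "\<forall>k\<in>{(1, 2), (2, 1), (2, 3), (3, 2)}. m k = m' k"
      using labels rim by metis
    show ?case
      using rim inner0 by (simp add: ends_def lessThan_Suc numeral_eq_Suc)
  qed
  moreover have "rim_determines X up lo ?T'"
    by (simp add: rim_determines_def mosaic_simps ends_def rim_def lessThan_Suc)
  moreover have "extends X up lo ?T ?T'"
    unfolding extends_def
  proof (intro allI impI, goal_cases)
    case (1 m)
    show ?case
      by (rule exI[of _ m]) (use Gamma1_labeling(1,2)[OF 1] in \<open>simp add: mosaic_simps\<close>)
  qed
  moreover have "extends X up lo ?T' ?T"
    unfolding extends_def
  proof (intro allI impI, goal_cases)
    case (1 m)
    show ?case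
      by (rule exI[of _ "\<lambda>k. if k \<in> {(1, 2), (2, 1), (2, 3), (3, 2)} then up (m (3,0)) (m (3,0))
          else m k"])
        (use 1 in \<open>auto simp: mosaic_simps rim_def cancel_rules diag[symmetric]\<close>)
  qed
  ultimately show "exchangeable X up lo ?T ?T'"
    by (simp add: exchangeable_def)
qed

text \<open>
  Both crossings act on their over-strands by the label \<open>m (2, 3)\<close> of the under-strand between them and
  produce the same label on the arc that joins them in the east. As acting by a fixed label is
  an involution, the two over-strands also agree in the west.
\<close>
lemma Gamma2_labeling:
  assumes "mosaic_labeling X up lo
    [[NE, XH, SW],
     [SE, XH, NW]] m"
  shows "m (0, 1) \<in> X" "m (0, 3) \<in> X" "m (4, 3) = m (0, 3)"
    and "\<forall>k\<in>{(1, 2), (3, 2), (4, 1)}. m k = m (0, 1)"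
    and "m (2, 3) = up (m (0, 3)) (m (0, 1))"
    and "\<forall>k\<in>{(1, 4), (2, 5), (3, 4)}. m k = lo (m (0, 1)) (m (0, 3))"
proof -
  have *: "m (0, 1) \<in> X" "m (1, 2) = m (0, 1)" "m (0, 3) \<in> X" "m (2, 3) = up (m (0, 3)) (m (0, 1))"
    "m (1, 4) = lo (m (0, 1)) (m (0, 3))" "m (2, 5) = m (1, 4)" "m (3, 2) \<in> X" "m (4, 1) = m (3, 2)"
    "m (4, 3) = up (m (2, 3)) (m (3, 2))" "m (3, 4) = lo (m (3, 2)) (m (2, 3))" "m (3, 4) = m (2, 5)"
    using assms by (simp_all add: mosaic_simps, metis)
  \<comment> \<open>The two over-strands are joined in the east, and \<open>lo\<close> does not distinguish the two under-labels of a crossing.\<close>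
  have "m (3, 2) = lo (lo (m (0, 1)) (m (2, 3))) (m (2, 3))"
    using lo_lo[of "m (3, 2)" "m (2, 3)"] * by (simp add: lo_up)
  then have "m (3, 2) = m (0, 1)"
    using * by (simp add: lo_lo)
  with * show "m (0, 1) \<in> X" "m (0, 3) \<in> X" "m (4, 3) = m (0, 3)"
    and "\<forall>k\<in>{(1, 2), (3, 2), (4, 1)}. m k = m (0, 1)"
    and "m (2, 3) = up (m (0, 3)) (m (0, 1))"
    and "\<forall>k\<in>{(1, 4), (2, 5), (3, 4)}. m k = lo (m (0, 1)) (m (0, 3))"
    by (auto simp: up_up lo_up)
qed

lemma Gamma2:
  shows "well_matched
    [[NE, XH, SW],
     [SE, XH, NW]]
    [[NS, NS, Em],
     [NS, NS, Em]]"
      (is "well_matched ?T ?T'")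
    and "exchangeable X up lo
    [[NE, XH, SW],
     [SE, XH, NW]]
    [[NS, NS, Em],
     [NS, NS, Em]]"
proof -
  show "well_matched ?T ?T'"
    by (simp add: well_matched_def rectangular_def ends_def rim_def lessThan_Suc
        numeral_eq_Suc insert_commute)
  have "rim_determines X up lo ?T"
    unfolding rim_determines_def
  proof (intro allI impI, goal_cases)
    case (1 m m')
    note labels = Gamma2_labeling[OF 1(1)] Gamma2_labeling[OF 1(2)]
    have rim: "m (0, 1) = m' (0, 1)" "m (0, 3) = m' (0, 3)" "m (4, 1) = m' (4, 1)" "m (4, 3) = m' (4, 3)"
      using 1(3) by (simp_all add: ends_def rim_def lessThan_Suc numeral_eq_Suc)
    have inner0: "\<forall>k\<in>{(1, 2), (3, 2), (4, 1)}. m k = m' k"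
      using labels rim by metis
    have inner1: "\<forall>k\<in>{(1, 4), (2, 5), (3, 4)}. m k = m' k"
      using labels rim by metis
    have inner2: "m (2, 3) = m' (2, 3)"
      using labels rim by metis
    show ?case
      using rim inner0 inner1 inner2 by (simp add: ends_def lessThan_Suc numeral_eq_Suc)
  qed
  moreover have "rim_determines X up lo ?T'"
    by (simp add: rim_determines_def mosaic_simps ends_def rim_def lessThan_Suc)
  moreover have "extends X up lo ?T ?T'"
    unfolding extends_def
  proof (intro allI impI, goal_cases)
    case (1 m)
    have *: "m (4, 1) = m (0, 1)"
      using Gamma2_labeling(4)[OF 1] by blast
    show ?case
      by (rule exI[of _ "\<lambda>k. if k \<in> {(2, 1)} then m (0,1)
          else if k \<in> {(2, 3)} then m (0,3)
          else m k"])
        (use * Gamma2_labeling(1-3)[OF 1] in \<open>auto simp: mosaic_simps rim_def\<close>)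
  qed
  moreover have "extends X up lo ?T' ?T"
    unfolding extends_def
  proof (intro allI impI, goal_cases)
    case (1 m)
    show ?case
      by (rule exI[of _ "\<lambda>k. if k \<in> {(1, 2), (3, 2)} then m (0,1)
          else if k \<in> {(2, 3)} then up (m (0,3)) (m (0,1))
          else if k \<in> {(1, 4), (2, 5), (3, 4)} then lo (m (0,1)) (m (0,3))
          else m k"])
        (use 1 in \<open>auto simp: mosaic_simps rim_def cancel_rules diag\<close>)
  qed
  ultimately show "exchangeable X up lo ?T ?T'"
    by (simp add: exchangeable_def)
qed

lemma Gamma3:
  shows "well_matched
    [[WE, XH, SW],
     [WE, XV, XV],
     [Em, NS, NS]]
    [[SW, NS, Em],
     [XV, XV, WE],
     [NE, XH, SW]]"
      (is "well_matched ?T ?T'")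
    and "exchangeable X up lo
    [[WE, XH, SW],
     [WE, XV, XV],
     [Em, NS, NS]]
    [[SW, NS, Em],
     [XV, XV, WE],
     [NE, XH, SW]]"
proof -
  show "well_matched ?T ?T'"
    by (simp add: well_matched_def rectangular_def ends_def rim_def lessThan_Suc
        numeral_eq_Suc insert_commute)
  have "rim_determines X up lo ?T"
    by (simp add: rim_determines_def mosaic_simps ends_def rim_def lessThan_Suc)
  moreover have "rim_determines X up lo ?T'"
    by (simp add: rim_determines_def mosaic_simps ends_def rim_def lessThan_Suc)
  moreover have "extends X up lo ?T ?T'"
    unfolding extends_def
  proof (intro allI impI, goal_cases)
    case (1 m)
    show ?case
      by (rule exI[of _ "\<lambda>k. if k \<in> {(2, 1)} then m (1,0)
          else if k \<in> {(2, 3)} then m (0,3)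
          else if k \<in> {(3, 2)} then up (m (3,0)) (m (1,0))
          else if k \<in> {(4, 1), (5, 2)} then lo (m (1,0)) (m (3,0))
          else if k \<in> {(3, 4)} then up (up (m (3,0)) (m (1,0))) (m (0,3))
          else if k \<in> {(4, 3)} then lo (m (0,3)) (up (m (3,0)) (m (1,0)))
          else if k \<in> {(5, 4)} then lo (lo (m (1,0)) (m (3,0))) (lo (m (0,3)) (up (m (3,0)) (m (1,0))))
          else m k"])
        (use 1 in \<open>auto simp: mosaic_simps rim_def cancel_rules triangle\<close>)
  qed
  moreover have "extends X up lo ?T' ?T"
    unfolding extends_def
  proof (intro allI impI, goal_cases)
    case (1 m)
    show ?case
      by (rule exI[of _ "\<lambda>k. if k \<in> {(1, 2)} then m (1,0)
          else if k \<in> {(3, 2)} then m (3,0)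
          else if k \<in> {(2, 3)} then up (m (0,3)) (m (1,0))
          else if k \<in> {(1, 4), (2, 5)} then lo (m (1,0)) (m (0,3))
          else if k \<in> {(3, 4)} then up (m (3,0)) (up (m (0,3)) (m (1,0)))
          else if k \<in> {(4, 3)} then lo (up (m (0,3)) (m (1,0))) (m (3,0))
          else if k \<in> {(4, 5)} then lo (lo (m (1,0)) (m (0,3))) (up (m (3,0)) (up (m (0,3)) (m (1,0))))
          else m k"])
        (use 1 in \<open>auto simp: mosaic_simps rim_def cancel_rules triangle\<close>)
  qed
  ultimately show "exchangeable X up lo ?T ?T'"
    by (simp add: exchangeable_def)
qed

lemma Gamma4:
  shows "well_matched
    [[WE, XH, SW],
     [WE, ME, XV],
     [Em, NS, NS]]
    [[SW, NS, Em],
     [XV, ME, WE],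
     [NE, XH, SW]]"
      (is "well_matched ?T ?T'")
    and "exchangeable X up lo
    [[WE, XH, SW],
     [WE, ME, XV],
     [Em, NS, NS]]
    [[SW, NS, Em],
     [XV, ME, WE],
     [NE, XH, SW]]"
proof -
  show "well_matched ?T ?T'"
    by (simp add: well_matched_def rectangular_def ends_def rim_def lessThan_Suc
        numeral_eq_Suc insert_commute)
  have "rim_determines X up lo ?T"
    by (simp add: rim_determines_def mosaic_simps ends_def rim_def lessThan_Suc)
  moreover have "rim_determines X up lo ?T'"
    by (simp add: rim_determines_def mosaic_simps ends_def rim_def lessThan_Suc)
  moreover have "extends X up lo ?T ?T'"
    unfolding extends_def
  proof (intro allI impI, goal_cases)
    case (1 m)
    show ?case
      by (rule exI[of _ "\<lambda>k. if k \<in> {(2, 1), (5, 4)} then m (1,0)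
          else if k \<in> {(2, 3), (3, 2), (3, 4), (4, 3)} then m (0,3)
          else if k \<in> {(4, 1), (5, 2)} then lo (m (1,0)) (m (0,3))
          else m k"])
        (use 1 in \<open>auto simp: mosaic_simps rim_def cancel_rules diag, (metis up_up lo_up)+\<close>)
  qed
  moreover have "extends X up lo ?T' ?T"
    unfolding extends_def
  proof (intro allI impI, goal_cases)
    case (1 m)
    show ?case
      by (rule exI[of _ "\<lambda>k. if k \<in> {(1, 2), (4, 5)} then m (1,0)
          else if k \<in> {(2, 3), (3, 2), (3, 4), (4, 3)} then up (m (0,3)) (m (1,0))
          else if k \<in> {(1, 4), (2, 5)} then lo (m (1,0)) (m (0,3))
          else m k"])
        (use 1 in \<open>auto simp: mosaic_simps rim_def cancel_rules diag\<close>)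
  qed
  ultimately show "exchangeable X up lo ?T ?T'"
    by (simp add: exchangeable_def)
qed

lemma Gamma5:
  shows "well_matched
    [[ME, SW],
     [NE, XH]]
    [[XH, SW],
     [NE, ME]]"
      (is "well_matched ?T ?T'")
    and "exchangeable X up lo
    [[ME, SW],
     [NE, XH]]
    [[XH, SW],
     [NE, ME]]"
proof -
  show "well_matched ?T ?T'"
    by (simp add: well_matched_def rectangular_def ends_def rim_def lessThan_Suc
        numeral_eq_Suc insert_commute)
  have "rim_determines X up lo ?T"
    by (simp add: rim_determines_def mosaic_simps ends_def rim_def lessThan_Suc)
  moreover have "rim_determines X up lo ?T'"
    by (simp add: rim_determines_def mosaic_simps ends_def rim_def lessThan_Suc)
  moreover have "extends X up lo ?T ?T'"
    unfolding extends_def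
  proof (intro allI impI, goal_cases)
    case (1 m)
    show ?case
      by (rule exI[of _ "\<lambda>k. if k \<in> {(1, 2), (2, 1), (2, 3), (3, 2)} then up (m (0,1)) (m (0,1))
          else m k"])
        (use 1 in \<open>auto simp: mosaic_simps rim_def cancel_rules diag\<close>)
  qed
  moreover have "extends X up lo ?T' ?T"
    unfolding extends_def
  proof (intro allI impI, goal_cases)
    case (1 m)
    show ?case
      by (rule exI[of _ "\<lambda>k. if k \<in> {(1, 2), (2, 1), (2, 3), (3, 2)} then m (0,1)
          else m k"])
        (use 1 in \<open>auto simp: mosaic_simps rim_def cancel_rules diag, (metis equal_inputs diag)+\<close>)
  qed
  ultimately show "exchangeable X up lo ?T ?T'"
    by (simp add: exchangeable_def)
qed

lemma Gamma6:
  shows "well_matched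
    [[SE, SW],
     [ME, NW]]
    [[Em, Em],
     [SW, Em]]"
      (is "well_matched ?T ?T'")
    and "exchangeable X up lo
    [[SE, SW],
     [ME, NW]]
    [[Em, Em],
     [SW, Em]]"
proof -
  show "well_matched ?T ?T'"
    by (simp add: well_matched_def rectangular_def ends_def rim_def lessThan_Suc
        numeral_eq_Suc insert_commute)
  have "rim_determines X up lo ?T"
    by (simp add: rim_determines_def mosaic_simps ends_def rim_def lessThan_Suc)
  moreover have "rim_determines X up lo ?T'"
    by (simp add: rim_determines_def mosaic_simps ends_def rim_def lessThan_Suc)
  moreover have "extends X up lo ?T ?T'"
    unfolding extends_def
  proof (intro allI impI, goal_cases)
    case (1 m)
    show ?case
      by (rule exI[of _ "\<lambda>k. m k"])
        (use 1 in \<open>auto simp: mosaic_simps rim_def cancel_rules diag\<close>)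
  qed
  moreover have "extends X up lo ?T' ?T"
    unfolding extends_def
  proof (intro allI impI, goal_cases)
    case (1 m)
    show ?case
      by (rule exI[of _ "\<lambda>k. if k \<in> {(1, 2), (2, 1), (2, 3), (3, 2)} then m (3,0)
          else m k"])
        (use 1 in \<open>auto simp: mosaic_simps rim_def cancel_rules diag\<close>)
  qed
  ultimately show "exchangeable X up lo ?T ?T'"
    by (simp add: exchangeable_def)
qed

lemma Gamma7:
  shows "well_matched
    [[SE, NW, NS],
     [ME, WE, MW],
     [NS, SE, NW]]
    [[SE, ME, NW],
     [NW, NS, SE],
     [SE, MW, NW]]"
      (is "well_matched ?T ?T'")
    and "exchangeable X up lo
    [[SE, NW, NS],
     [ME, WE, MW],
     [NS, SE, NW]]
    [[SE, ME, NW],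
     [NW, NS, SE],
     [SE, MW, NW]]"
proof -
  show "well_matched ?T ?T'"
    by (simp add: well_matched_def rectangular_def ends_def rim_def lessThan_Suc
        numeral_eq_Suc insert_commute)
  have "rim_determines X up lo ?T"
    by (simp add: rim_determines_def mosaic_simps ends_def rim_def lessThan_Suc)
  moreover have "rim_determines X up lo ?T'"
    by (simp add: rim_determines_def mosaic_simps ends_def rim_def lessThan_Suc)
  moreover have "extends X up lo ?T ?T'"
    unfolding extends_def
  proof (intro allI impI, goal_cases)
    case (1 m)
    show ?case
      by (rule exI[of _ "\<lambda>k. if k \<in> {(1, 2), (2, 1), (1, 4), (2, 3), (4, 3), (4, 5), (5, 2), (5, 4)} then m (3,0)
          else m k"])
        (use 1 in \<open>auto simp: mosaic_simps rim_def cancel_rules diag\<close>)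
  qed
  moreover have "extends X up lo ?T' ?T"
    unfolding extends_def
  proof (intro allI impI, goal_cases)
    case (1 m)
    show ?case
      by (rule exI[of _ "\<lambda>k. if k \<in> {(1, 2), (2, 1), (2, 5), (3, 2), (3, 4), (4, 1), (4, 5), (5, 4)} then m (3,0)
          else m k"])
        (use 1 in \<open>auto simp: mosaic_simps rim_def cancel_rules diag\<close>)
  qed
  ultimately show "exchangeable X up lo ?T ?T'"
    by (simp add: exchangeable_def)
qed

lemma Gamma8:
  shows "well_matched
    [[MW, WE, XH, WE, SW],
     [NE, WE, XH, SW, NS],
     [WE, WE, ME, XH, XH],
     [Em, Em, NS, NS, NS],
     [Em, Em, NS, NS, NS]]
    [[MW, SW, NS, Em, Em],
     [NS, NS, NS, Em, Em],
     [XV, XV, ME, WE, WE],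
     [NS, NE, XV, WE, SW],
     [NE, WE, XV, SW, NS]]"
      (is "well_matched ?T ?T'")
    and "exchangeable X up lo
    [[MW, WE, XH, WE, SW],
     [NE, WE, XH, SW, NS],
     [WE, WE, ME, XH, XH],
     [Em, Em, NS, NS, NS],
     [Em, Em, NS, NS, NS]]
    [[MW, SW, NS, Em, Em],
     [NS, NS, NS, Em, Em],
     [XV, XV, ME, WE, WE],
     [NS, NE, XV, WE, SW],
     [NE, WE, XV, SW, NS]]"
proof -
  show "well_matched ?T ?T'"
    by (simp add: well_matched_def rectangular_def ends_def rim_def lessThan_Suc
        numeral_eq_Suc insert_commute)
  have "rim_determines X up lo ?T"
    by (simp add: rim_determines_def mosaic_simps ends_def rim_def lessThan_Suc)
  moreover have "rim_determines X up lo ?T'"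
    by (simp add: rim_determines_def mosaic_simps ends_def rim_def lessThan_Suc)
  moreover have "extends X up lo ?T ?T'"
    unfolding extends_def
  proof (intro allI impI, goal_cases)
    case (1 m)
    show ?case
      by (rule exI[of _ "\<lambda>k. if k \<in> {(1, 2), (2, 1), (2, 3), (4, 1), (4, 3)} then m (0,1)
          else if k \<in> {(5, 2)} then up (m (0,5)) (m (0,1))
          else if k \<in> {(2, 5), (4, 5), (5, 4), (5, 6), (5, 8), (6, 5)} then m (0,5)
          else if k \<in> {(6, 1), (6, 3), (7, 4), (8, 1), (9, 2), (9, 4)} then lo (m (0,1)) (m (0,5))
          else if k \<in> {(8, 5)} then lo (m (0,5)) (lo (m (0,1)) (m (0,5)))
          else if k \<in> {(7, 6), (7, 8), (8, 9), (9, 6)} then up (lo (m (0,1)) (m (0,5))) (m (0,5))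
          else m k"])
        (use 1 in \<open>auto simp: mosaic_simps rim_def cancel_rules diag\<close>)
  qed
  moreover have "extends X up lo ?T' ?T"
    unfolding extends_def
  proof (intro allI impI, goal_cases)
    case (1 m)
    show ?case
      by (rule exI[of _ "\<lambda>k. if k \<in> {(1, 2), (2, 1), (1, 4), (3, 2), (3, 4)} then m (0,1)
          else if k \<in> {(2, 5)} then up (m (0,5)) (m (0,1))
          else if k \<in> {(4, 5), (5, 2), (5, 4), (5, 6), (6, 5), (8, 5)} then m (0,5)
          else if k \<in> {(1, 6), (1, 8), (2, 9), (4, 9), (3, 6), (4, 7)} then lo (m (0,1)) (m (0,5))
          else if k \<in> {(5, 8)} then lo (m (0,5)) (lo (m (0,1)) (m (0,5)))
          else if k \<in> {(6, 7), (6, 9), (8, 7), (8, 9)} then up (lo (m (0,1)) (m (0,5))) (m (0,5))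
          else m k"])
        (use 1 in \<open>auto simp: mosaic_simps rim_def cancel_rules diag\<close>)
  qed
  ultimately show "exchangeable X up lo ?T ?T'"
    by (simp add: exchangeable_def)
qed

end

lemma ports_switch [simp]: "ports (switch t) = ports t"
  by (cases t) auto

lemma ports_exchange [simp]: "ports (exchange t) = ports t"
  by (cases t) auto

lemma tile_rule_switch [simp]: "tile_rule X up lo (switch t) m \<longleftrightarrow> tile_rule X lo up t m"
  by (cases t) (auto simp: crossing_labels_def)

lemma tile_rule_exchange [simp]: "tile_rule X up lo (exchange t) m \<longleftrightarrow> tile_rule X up lo t m"
  by (cases t) auto

lemma mosaic_labeling_switch [simp]:
  "mosaic_labeling X up lo (map (map switch) T) m \<longleftrightarrow> mosaic_labeling X lo up T m"
  by (simp add: mosaic_labeling_def)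

lemma mosaic_labeling_exchange [simp]:
  "mosaic_labeling X up lo (map (map exchange) T) m \<longleftrightarrow> mosaic_labeling X up lo T m"
  by (simp add: mosaic_labeling_def)

text \<open>
  Switching and exchanging replace tiles by tiles with the same ports, so the shape of a mosaic
  and its ends stay the same.
\<close>
lemma rectangular_map: "rectangular (map (map f) T) \<longleftrightarrow> rectangular T"
  by (cases T) (auto simp: rectangular_def)

lemma ends_map:
  assumes "\<And>t. ports (f t) = ports t"
  shows "ends (map (map f) T) = ends T"
  using assms by (simp add: ends_def)

lemma rim_map: "rectangular T \<Longrightarrow> rim (map (map f) T) = rim T"
  by (cases T) (simp_all add: rectangular_def rim_def)

lemma well_matched_map:
  assumes "\<And>t. ports (f t) = ports t" "well_matched T T'"
  shows "well_matched (map (map f) T) (map (map f) T')"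
proof -
  have "length (hd (map (map f) S)) = length (hd S)" if "rectangular S" for S
    using that by (cases S) (simp_all add: rectangular_def)
  then show ?thesis
    using assms by (simp add: well_matched_def ends_map rim_map rectangular_map)
qed

lemma exchangeable_switch:
  assumes "exchangeable X lo up T T'" "rectangular T" "rectangular T'"
  shows "exchangeable X up lo (map (map switch) T) (map (map switch) T')"
  using assms by (simp add: exchangeable_def rim_determines_def extends_def ends_map rim_map)

lemma exchangeable_exchange:
  assumes "exchangeable X up lo T T'" "rectangular T" "rectangular T'"
  shows "exchangeable X up lo (map (map exchange) T) (map (map exchange) T')"
  using assms by (simp add: exchangeable_def rim_determines_def extends_def ends_map rim_map)

lemma well_matched_sym: "well_matched T T' \<Longrightarrow> well_matched T' T"
  by (auto simp: well_matched_def)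

lemma exchangeable_sym: "exchangeable X up lo T T' \<Longrightarrow> exchangeable X up lo T' T"
  by (auto simp: exchangeable_def)

text \<open>
  The combinatorial content of the invariance theorem. The bikei is generalized in the induction because the switched moves use the dual bikei.
\<close>
theorem yoshikawa_exchangeable:
  assumes "yoshikawa T T'" "bikei X up lo"
  shows "well_matched T T' \<and> exchangeable X up lo T T'"
  using assms
proof (induction arbitrary: up lo rule: yoshikawa.induct)
  case (inverse T T')
  then show ?case using well_matched_sym exchangeable_sym by blast
next
  case (switched T T')
  then show ?case
    using bikei.dual[OF switched.prems] switched.IH[of lo up]
    by (auto intro!: well_matched_map exchangeable_switch) (auto simp: well_matched_def)
next
  case (exchanged T T')
  then show ?case
    using exchanged.IH[of up lo]
    by (auto intro!: well_matched_map exchangeable_exchange) (auto simp: well_matched_def)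
qed (blast intro: bikei.Gamma1 bikei.Gamma2 bikei.Gamma3 bikei.Gamma4 bikei.Gamma5 bikei.Gamma6
    bikei.Gamma7 bikei.Gamma8)+

section \<open>Labels as locally constant functions\<close>

abbreviation strands :: "diagram \<Rightarrow> complex set" where
  "strands L \<equiv> points L - vertices L"

definition directions :: "complex set" where
  "directions = {1, \<i>, -1, -\<i>}"

lemma mem_directions: "d \<in> directions \<longleftrightarrow> d = 1 \<or> d = \<i> \<or> d = -1 \<or> d = -\<i>"
  by (auto simp: directions_def)

lemma finite_directions: "finite directions"
  by (simp add: directions_def)

text \<open>
  Labels of semiarcs are the same thing as locally constant functions on the strands. Local
  constancy can be checked on the two sides of the frontier of a disk separately, whereas the semiarcs
  of a diagram change globally when it is modified inside the disk.
\<close>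
definition locally_constant :: "complex set \<Rightarrow> (complex \<Rightarrow> 'a) \<Rightarrow> bool" where
  "locally_constant M G \<longleftrightarrow> (\<forall>p\<in>M. \<forall>\<^sub>F q in at p within M. G q = G p)"

lemma locally_constant_connected:
  assumes "locally_constant M G" "connected C" "C \<subseteq> M" "p \<in> C" "q \<in> C"
  shows "G q = G p"
proof -
  have "continuous_on C (\<lambda>x. G x = G p)"
    unfolding continuous_on_def
  proof
    fix x assume x: "x \<in> C"
    have "\<forall>\<^sub>F y in at x within C. G y = G x"
      using assms(1,3) x filter_leD[OF at_le[OF assms(3)]] by (auto simp: locally_constant_def)
    then show "((\<lambda>x. G x = G p) \<longlongrightarrow> (G x = G p)) (at x within C)"
      by (intro tendsto_eventually) (auto elim: eventually_mono)
  qed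
  then show ?thesis
    using connectedD_const[OF assms(2)] assms(4,5) by blast
qed

lemma mem_star: "p \<in> star c A \<longleftrightarrow> (\<exists>d\<in>A. \<exists>t\<in>{0..1}. p = c + of_real t * d)"
proof -
  have "p \<in> closed_segment c (c + d) \<longleftrightarrow> (\<exists>t\<in>{0..1}. p = c + of_real t * d)" for d
    by (simp add: in_segment scaleR_conv_of_real algebra_simps Bex_def conj_assoc)
  then show ?thesis
    by (simp add: star_def)
qed

lemma norm_direction: "d \<in> directions \<Longrightarrow> cmod d = 1"
  by (auto simp: mem_directions)

lemma local_paramE:
  assumes "local_param L A p k"
  obtains U g where "open U" "homeomorphism (ball 0 1) U k g" "k 0 = p" "p \<in> U"
    "points L \<inter> U = k ` (star 0 A \<inter> ball 0 1)" "vertices L \<inter> U \<subseteq> {p}"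
proof -
  obtain U g where *: "open U" "homeomorphism (ball 0 1) U k g" "k 0 = p"
      "points L \<inter> U = k ` (star 0 A \<inter> ball 0 1)" "vertices L \<inter> U \<subseteq> {p}"
    using assms unfolding local_param_def by blast
  moreover have "p \<in> U"
    using homeomorphism_image1[OF *(2)] *(3) by (metis centre_in_ball imageI zero_less_one)
  ultimately show thesis using that by blast
qed

lemma param_in_strands:
  assumes "local_param L A p k" "z \<in> star 0 A" "cmod z < 1" "z \<noteq> 0"
  shows "k z \<in> strands L"
proof -
  obtain U g where U: "homeomorphism (ball 0 1) U k g" "k 0 = p"
      "points L \<inter> U = k ` (star 0 A \<inter> ball 0 1)" "vertices L \<inter> U \<subseteq> {p}"
    using assms(1) unfolding local_param_def by blast
  have "k z \<in> points L \<inter> U" using U assms by auto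
  moreover have "k z \<noteq> k 0"
    using homeomorphism_apply1[OF U(1), of z] homeomorphism_apply1[OF U(1), of 0] assms by auto
  ultimately show ?thesis using U by auto
qed

lemma arm_in_star:
  assumes "d \<in> directions" "0 < t" "t < 1"
  shows "of_real t * d \<in> star 0 directions" "cmod (of_real t * d) < 1" "of_real t * d \<noteq> 0"
proof -
  show "of_real t * d \<in> star 0 directions"
    unfolding mem_star by (rule bexI[OF _ assms(1)], rule bexI[of _ t]) (use assms in auto)
qed (use assms norm_direction[OF assms(1)] in \<open>auto simp: norm_mult\<close>)

lemma param_continuous: "local_param L A p k \<Longrightarrow> continuous_on (ball 0 1) k"
  by (auto simp: local_param_def homeomorphism_def)

lemma constant_along_arm:
  assumes "local_param L directions v k" "locally_constant (strands L) G"
    and "d \<in> directions" "0 < t" "t < 1"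
  shows "G (k (of_real t * d)) = G (k (d / 2))"
proof -
  let ?C = "(\<lambda>s. k (of_real s * d)) ` {0<..<1}"
  have "continuous_on {0<..<1} (\<lambda>s. k (complex_of_real s * d))"
    by (rule continuous_on_compose2[OF param_continuous[OF assms(1)]])
      (use norm_direction[OF assms(3)] in \<open>auto intro!: continuous_intros simp: norm_mult\<close>)
  then have "connected ?C"
    by (intro connected_continuous_image) auto
  moreover have "?C \<subseteq> strands L"
    using param_in_strands[OF assms(1) arm_in_star[OF assms(3)]] by auto
  moreover have "k (of_real t * d) \<in> ?C" "k (of_real (1/2) * d) \<in> ?C"
    using assms by (force, intro imageI, force)
  ultimately show ?thesis
    using locally_constant_connected[OF assms(2)] by fastforce
qed

text \<open>
  Near the vertex, the arm of \<open>k\<close> in direction \<open>d\<close> runs in the arm of \<open>k'\<close> in direction \<open>e\<close>.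
\<close>
definition follows :: "(complex \<Rightarrow> complex) \<Rightarrow> complex \<Rightarrow> (complex \<Rightarrow> complex) \<Rightarrow> complex \<Rightarrow> bool" where
  "follows k d k' e \<longleftrightarrow> (\<forall>\<epsilon>>0. \<exists>\<delta>>0. \<forall>t. 0 < t \<and> t < \<delta> \<longrightarrow>
     t < 1 \<and> (\<exists>s>0. s < \<epsilon> \<and> s < 1 \<and> k (of_real t * d) = k' (of_real s * e)))"

lemma followsE:
  assumes "follows k d k' e" "0 < \<epsilon>" "0 < \<eta>"
  obtains t s where "0 < t" "t < \<eta>" "t < 1" "0 < s" "s < \<epsilon>" "s < 1"
    "k (of_real t * d) = k' (of_real s * e)"
proof -
  obtain \<delta> where \<delta>: "\<delta> > 0" "\<And>t. 0 < t \<and> t < \<delta> \<longrightarrow>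
      t < 1 \<and> (\<exists>s>0. s < \<epsilon> \<and> s < 1 \<and> k (of_real t * d) = k' (of_real s * e))"
    using assms(1,2) unfolding follows_def by blast
  then show thesis
    using that[of "min \<delta> \<eta> / 2"] \<delta>(2)[of "min \<delta> \<eta> / 2"] assms(3) by force
qed

text \<open>
  A short initial piece of an arm of \<open>k\<close>, seen through \<open>k'\<close>, lies in the star without its centre.
  There the direction \<^const>\<open>sgn\<close> is continuous with finitely many values, hence constant along
  the arm.
\<close>
lemma arm_direction:
  assumes k: "local_param L directions v k" and k': "local_param L' directions v k'"
    and W: "open W" "v \<in> W" "points L \<inter> W = points L' \<inter> W"
    and d: "d \<in> directions"
  shows "\<exists>e\<in>directions. follows k d k' e"
proof -
  obtain U g where U: "open U" "homeomorphism (ball 0 1) U k g" "k 0 = v" "v \<in> U"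
      "points L \<inter> U = k ` (star 0 directions \<inter> ball 0 1)" "vertices L \<inter> U \<subseteq> {v}"
    using local_paramE[OF k] .
  obtain U' g' where U': "open U'" "homeomorphism (ball 0 1) U' k' g'" "k' 0 = v" "v \<in> U'"
      "points L' \<inter> U' = k' ` (star 0 directions \<inter> ball 0 1)" "vertices L' \<inter> U' \<subseteq> {v}"
    using local_paramE[OF k'] .
  have contk: "continuous_on (ball 0 1) k" and inv: "\<And>z. z \<in> ball 0 1 \<Longrightarrow> g (k z) = z"
    and cont': "continuous_on U' g'" and inv': "\<And>z. z \<in> ball 0 1 \<Longrightarrow> g' (k' z) = z"
    using U(2) U'(2) by (auto simp: homeomorphism_def)
  have "open (k -` (U' \<inter> W) \<inter> ball 0 1)"
    using continuous_open_preimage[OF contk open_ball, of "U' \<inter> W"] U' W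
    by (simp add: Int_commute open_Int)
  moreover have "0 \<in> k -` (U' \<inter> W) \<inter> ball 0 1"
    using U U' W by auto
  ultimately obtain \<delta> where \<delta>: "\<delta> > 0" "ball 0 \<delta> \<subseteq> k -` (U' \<inter> W) \<inter> ball 0 1"
    by (rule openE) (rule that)
  define \<phi> where "\<phi> t = g' (k (of_real t * d))" for t :: real
  have in_ball: "of_real t * d \<in> ball 0 \<delta>" if "\<bar>t\<bar> < \<delta>" for t
    using norm_direction[OF d] that by (simp add: norm_mult)
  have cont\<phi>: "continuous_on {-\<delta><..<\<delta>} \<phi>"
    unfolding \<phi>_def
  proof (rule continuous_on_compose2[OF cont'])
    show "continuous_on {-\<delta><..<\<delta>} (\<lambda>t. k (complex_of_real t * d))"
      by (rule continuous_on_compose2[OF contk])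
        (use in_ball \<delta>(2) in \<open>auto intro!: continuous_intros simp: subset_iff\<close>)
    show "(\<lambda>t. k (complex_of_real t * d)) ` {-\<delta><..<\<delta>} \<subseteq> U'"
    proof (rule image_subsetI)
      fix t assume "t \<in> {-\<delta><..<\<delta>}"
      then have "of_real t * d \<in> ball 0 \<delta>" by (intro in_ball) auto
      then show "k (of_real t * d) \<in> U'" using \<delta>(2) by blast
    qed
  qed
  have \<phi>: "\<phi> t \<in> star 0 directions \<inter> ball 0 1 \<and> k (of_real t * d) = k' (\<phi> t) \<and> \<phi> t \<noteq> 0 \<and> t < 1"
    if "0 < t" "t < \<delta>" for t
  proof -
    have z: "of_real t * d \<in> ball 0 1" "k (of_real t * d) \<in> U' \<inter> W"
      using in_ball[of t] that \<delta>(2) by auto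
    then have t: "t < 1" using norm_direction[OF d] that by (simp add: norm_mult)
    have "k (of_real t * d) \<in> strands L"
      using param_in_strands[OF k arm_in_star[OF d]] that t by simp
    then have "k (of_real t * d) \<in> points L' \<inter> U'" using z W(3) by blast
    then obtain w where w: "w \<in> star 0 directions \<inter> ball 0 1" "k (of_real t * d) = k' w"
      using U'(5) by auto
    then have "\<phi> t = w" using inv' by (auto simp: \<phi>_def)
    moreover have "k (of_real t * d) \<noteq> k 0"
      using inv[of "of_real t * d"] inv[of 0] z arm_in_star(3)[OF d that(1) t] by auto
    then have "w \<noteq> 0" using w(2) U(3) U'(3) by auto
    ultimately show ?thesis using w t by auto
  qed
  have sgn_dir: "sgn w \<in> directions" if "w \<in> star 0 directions" "w \<noteq> 0" for w
    using that by (auto simp: mem_star mem_directions sgn_mult sgn_of_real sgn_eq[of \<i>])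
  have "continuous_on {0<..<\<delta>} (\<lambda>t. sgn (\<phi> t))"
    using \<phi> by (intro continuous_intros continuous_on_subset[OF cont\<phi>]) auto
  moreover have "(\<lambda>t. sgn (\<phi> t)) ` {0<..<\<delta>} \<subseteq> directions"
    by (intro image_subsetI sgn_dir) (use \<phi> in auto)
  ultimately have "(\<lambda>t. sgn (\<phi> t)) constant_on {0<..<\<delta>}"
    by (intro continuous_finite_range_constant) (auto intro: finite_subset[OF _ finite_directions])
  then obtain e where e: "sgn (\<phi> t) = e" if "0 < t" "t < \<delta>" for t
    by (auto simp: constant_on_def)
  have "e \<in> directions"
    using e[of "\<delta>/2"] sgn_dir[of "\<phi> (\<delta>/2)"] \<phi>[of "\<delta>/2"] \<delta>(1) by auto
  moreover have "\<exists>\<eta>>0. \<forall>t. 0 < t \<and> t < \<eta> \<longrightarrow>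
       t < 1 \<and> (\<exists>s>0. s < \<epsilon> \<and> s < 1 \<and> k (of_real t * d) = k' (of_real s * e))"
    if "0 < \<epsilon>" for \<epsilon>
  proof -
    have "\<phi> 0 = 0" using inv'[of 0] U(3) U'(3) by (simp add: \<phi>_def)
    moreover have "isCont \<phi> 0"
      using cont\<phi> \<delta>(1) by (simp add: continuous_on_eq_continuous_at)
    ultimately have "\<forall>\<^sub>F t in at 0. cmod (\<phi> t) < \<epsilon>"
      using that tendstoD[of \<phi> 0 "at 0" \<epsilon>] by (simp add: isCont_def)
    then obtain \<eta> where \<eta>: "\<eta> > 0" "\<And>t. 0 < t \<Longrightarrow> t < \<eta> \<Longrightarrow> cmod (\<phi> t) < \<epsilon>"
      unfolding eventually_at by (auto simp: dist_real_def)
    show ?thesis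
    proof (rule exI[of _ "min \<eta> \<delta>"], intro conjI allI impI)
      fix t assume t: "0 < t \<and> t < min \<eta> \<delta>"
      show "t < 1" using \<phi>[of t] t by auto
      have "\<phi> t = of_real (cmod (\<phi> t)) * e"
        using e[of t, symmetric] \<phi>[of t] t by (simp add: sgn_eq)
      then show "\<exists>s>0. s < \<epsilon> \<and> s < 1 \<and> k (of_real t * d) = k' (of_real s * e)"
        using \<phi>[of t] \<eta>(2)[of t] t by (intro exI[of _ "cmod (\<phi> t)"]) auto
    qed (use \<eta> \<delta> in auto)
  qed
  ultimately show ?thesis
    unfolding follows_def by (intro bexI[of _ e]) simp_all
qed

text \<open>
  Two parametrizations at the same vertex differ by a permutation of the four arms as far as labels are
  concerned, and the permutation respects the over-strand if the germs agree. The two diagrams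
  and labelings only have to coincide near the vertex, so this compares different parametrizations of
  one diagram and also a diagram with its modification elsewhere. The permutation is
  injective: an arm of \<open>k\<close> that follows an arm of \<open>k'\<close> must be the arm that this one follows in turn.
\<close>
lemma labels_match:
  assumes k: "local_param L directions v k" and k': "local_param L' directions v k'"
    and W: "open W" "v \<in> W" "points L \<inter> W = points L' \<inter> W"
    and G: "locally_constant (strands L) G" "locally_constant (strands L') G'"
    and eq: "\<And>p. p \<in> strands L \<inter> W \<Longrightarrow> G p = G' p"
  shows "\<exists>\<sigma>. bij_betw \<sigma> directions directions \<and>
    (\<forall>d\<in>directions. G (k (d / 2)) = G' (k' (\<sigma> d / 2))) \<and>
    (filtermap k (at 0 within star 0 {1, -1}) = filtermap k' (at 0 within star 0 {1, -1}) \<longrightarrow>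
       (\<forall>d\<in>{1, -1}. \<sigma> d \<in> {1, -1}))"
proof -
  have inj: "inj_on k (ball 0 1)" "inj_on k' (ball 0 1)"
    using k k' by (metis local_param_def homeomorphism_def inj_on_inverseI)+
  have "\<exists>\<sigma>. \<forall>d\<in>directions. \<sigma> d \<in> directions \<and> follows k d k' (\<sigma> d)"
    by (intro bchoice ballI) (use arm_direction[OF k k' W] in \<open>simp only: Bex_def\<close>)
  then obtain \<sigma> where \<sigma>: "\<And>d. d \<in> directions \<Longrightarrow> \<sigma> d \<in> directions"
    "\<And>d. d \<in> directions \<Longrightarrow> follows k d k' (\<sigma> d)"
    by blast
  have \<sigma>_unique: "d = d'" if d: "d \<in> directions" "d' \<in> directions" and eq: "\<sigma> d = \<sigma> d'" for d d'
  proof -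
    obtain e where e: "e \<in> directions" "follows k' (\<sigma> d) k e"
      using arm_direction[OF k' k W(1,2) W(3)[symmetric] \<sigma>(1)[OF d(1)]] by blast
    have "b = e" if b: "b \<in> directions" "\<sigma> b = \<sigma> d" for b
    proof -
      obtain \<epsilon> where \<epsilon>: "\<epsilon> > 0" "\<forall>t. 0 < t \<and> t < \<epsilon> \<longrightarrow>
          t < 1 \<and> (\<exists>s>0. s < 1 \<and> s < 1 \<and> k' (of_real t * \<sigma> d) = k (of_real s * e))"
        using e(2)[unfolded follows_def, rule_format, OF zero_less_one] by blast
      obtain t s where s: "0 < t" "t < 1" "0 < s" "s < \<epsilon>" "k (of_real t * b) = k' (of_real s * \<sigma> d)"
        by (rule followsE[OF \<sigma>(2)[OF b(1)] \<epsilon>(1) zero_less_one]) (use b(2) that in auto)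
      obtain r where r: "0 < r" "r < 1" "k (of_real t * b) = k (of_real r * e)"
        using \<epsilon>(2)[rule_format, of s] s(3-5) by auto
      have "of_real t * b = of_real r * e"
        using inj_onD[OF inj(1) r(3)] arm_in_star(2)[OF b(1) s(1,2)] arm_in_star(2)[OF e(1) r(1,2)]
        by simp
      moreover from this have "cmod (of_real t * b) = cmod (of_real r * e)"
        by simp
      then have "t = r"
        using norm_direction[OF b(1)] norm_direction[OF e(1)] s(1) r(1) by (simp add: norm_mult)
      ultimately show ?thesis using s(1) by simp
    qed
    from this[OF d(1) refl] this[OF d(2) eq[symmetric]] show ?thesis by simp
  qed
  have "inj_on \<sigma> directions"
    using \<sigma>_unique by (intro inj_onI)
  moreover have "\<sigma> ` directions \<subseteq> directions"
    using \<sigma>(1) by blast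
  ultimately have bij: "bij_betw \<sigma> directions directions"
    unfolding bij_betw_def by (intro conjI endo_inj_surj finite_directions)
  have labels: "G (k (d / 2)) = G' (k' (\<sigma> d / 2))" if d: "d \<in> directions" for d
  proof -
    have "open (k -` W \<inter> ball 0 1)"
      using continuous_open_preimage[OF param_continuous[OF k] open_ball W(1)] by (simp add: Int_commute)
    moreover have "k 0 = v"
      using k by (rule local_paramE)
    then have "0 \<in> k -` W \<inter> ball 0 1"
      using W(2) by simp
    ultimately obtain \<eta> where \<eta>: "\<eta> > 0" "ball 0 \<eta> \<subseteq> k -` W \<inter> ball 0 1"
      by (rule openE) (rule that)
    obtain t s where t: "0 < t" "t < \<eta>" and s: "t < 1" "0 < s" "s < 1"
        "k (of_real t * d) = k' (of_real s * \<sigma> d)"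
      by (rule followsE[OF \<sigma>(2)[OF d] zero_less_one \<eta>(1)]) (rule that)
    have "k (of_real t * d) \<in> W"
      using \<eta>(2) t norm_direction[OF d] by (auto simp: norm_mult subset_iff)
    moreover have "k (of_real t * d) \<in> strands L"
      using param_in_strands[OF k arm_in_star[OF d t(1) s(1)]] .
    ultimately have "G (k (of_real t * d)) = G' (k' (of_real s * \<sigma> d))"
      using eq s(4) by (metis IntI)
    then show ?thesis
      using constant_along_arm[OF k G(1) d t(1) s(1)] constant_along_arm[OF k' G(2) \<sigma>(1)[OF d] s(2,3)]
      by simp
  qed
  have over: "\<sigma> d \<in> {1, -1}"
    if germ: "filtermap k (at 0 within star 0 {1, -1}) = filtermap k' (at 0 within star 0 {1, -1})"
      and d: "d \<in> {1, -1}" for d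
  proof -
    \<comment> \<open>Equal germs: near 0, the over-strand of \<open>k\<close> runs in that of \<open>k'\<close>.\<close>
    let ?S = "k' ` (star 0 {1, -1} \<inter> ball 0 1)"
    have "eventually (\<lambda>x. x \<in> ?S) (filtermap k' (at 0 within star 0 {1, -1}))"
      unfolding eventually_filtermap eventually_at by (rule exI[of _ 1]) auto
    then have "\<forall>\<^sub>F z in at 0 within star 0 {1, -1}. k z \<in> ?S"
      unfolding germ[symmetric] eventually_filtermap .
    then obtain \<eta> where \<eta>: "\<eta> > 0"
      "\<And>z. z \<in> star 0 {1, -1} \<Longrightarrow> z \<noteq> 0 \<Longrightarrow> cmod z < \<eta> \<Longrightarrow> k z \<in> k' ` (star 0 {1, -1} \<inter> ball 0 1)"
      unfolding eventually_at by auto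
    have dir: "d \<in> directions" using d by (auto simp: mem_directions)
    obtain t s where t: "0 < t" "t < \<eta>" and s: "t < 1" "0 < s" "s < 1"
        "k (of_real t * d) = k' (of_real s * \<sigma> d)"
      by (rule followsE[OF \<sigma>(2)[OF dir] zero_less_one \<eta>(1)]) (rule that)
    have "of_real t * d \<in> star 0 {1, -1}"
      unfolding mem_star by (rule bexI[OF _ d], rule bexI[of _ t]) (use t s in auto)
    then obtain w where w: "w \<in> star 0 {1, -1} \<inter> ball 0 1" "k (of_real t * d) = k' w"
      using \<eta>(2)[of "of_real t * d"] t arm_in_star(3)[OF dir t(1) s(1)] norm_direction[OF dir]
      by (auto simp: norm_mult)
    have "of_real s * \<sigma> d = w"
      using inj_onD[OF inj(2), of "of_real s * \<sigma> d" w] s w arm_in_star(2)[OF \<sigma>(1)[OF dir] s(2,3)] by simp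
    then have "Im (\<sigma> d) = 0"
      using w(1) s(2) by (auto simp: mem_star complex_eq_iff)
    then show ?thesis using \<sigma>(1)[OF dir] by (auto simp: mem_directions)
  qed
  show ?thesis
    by (rule exI[of _ \<sigma>], intro conjI impI ballI bij labels over)
qed

text \<open>
  Labelings as functions of points of the strands. At a crossing a single relation between four labels
  is demanded; \<^const>\<open>crossing_labels\<close> is symmetric enough to make this equivalent to the
  condition in \<^const>\<open>labeling\<close>.
\<close>
definition point_labeling ::
  "'a set \<Rightarrow> ('a \<Rightarrow> 'a \<Rightarrow> 'a) \<Rightarrow> ('a \<Rightarrow> 'a \<Rightarrow> 'a) \<Rightarrow> diagram \<Rightarrow> (complex \<Rightarrow> 'a) \<Rightarrow> bool" where
  "point_labeling X up lo L G \<longleftrightarrow>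
     G ` strands L \<subseteq> X \<and> locally_constant (strands L) G \<and>
     (\<forall>v\<in>crossings L. \<forall>k. crossing_param L v k \<longrightarrow>
        crossing_labels X up lo (G (k (\<i> / 2))) (G (k (-\<i> / 2))) (G (k (1 / 2))) (G (k (-1 / 2)))) \<and>
     (\<forall>v\<in>saddles L. \<forall>k. saddle_param L v k \<longrightarrow>
        (\<forall>d\<in>directions. \<forall>d'\<in>directions. G (k (d / 2)) = G (k (d' / 2))))"

lemma half_arm_in_strands:
  assumes "local_param L directions v k" "d \<in> directions"
  shows "k (d / 2) \<in> strands L"
  using param_in_strands[OF assms(1) arm_in_star[OF assms(2), of "1/2"]] by simp

lemma crossing_local_param: "crossing_param L v k \<Longrightarrow> local_param L directions v k"
  and saddle_local_param: "saddle_param L v k \<Longrightarrow> local_param L directions v k"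
  by (simp_all add: crossing_param_def saddle_param_def directions_def)

text \<open>
  Near a point of a strand the diagram is a connected arc, which lies in one semiarc.
\<close>
lemma label_locally_constant:
  assumes "marked_vertex_diagram L"
  shows "locally_constant (strands L) (label L f)"
  unfolding locally_constant_def
proof
  fix p assume p: "p \<in> strands L"
  then obtain k where "local_param L {1, -1} p k"
    using assms unfolding marked_vertex_diagram_def by blast
  then obtain U g where U: "open U" "homeomorphism (ball 0 1) U k g" "p \<in> U"
    "points L \<inter> U = k ` (star 0 {1, -1} \<inter> ball 0 1)" "vertices L \<inter> U \<subseteq> {p}"
    by (elim local_paramE) blast
  have "star 0 {1, -1} \<inter> ball 0 1 = complex_of_real ` {-1<..<1}"
  proof (intro equalityI subsetI)
    fix z assume "z \<in> star 0 {1, -1} \<inter> ball 0 1"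
    then obtain d t where "d \<in> {1, -1}" "t \<in> {0..1}" "z = 0 + of_real t * d" "cmod z < 1"
      unfolding Int_iff mem_star by (metis mem_ball_0)
    then show "z \<in> complex_of_real ` {-1<..<1}"
      by (cases "d = 1") (auto intro: image_eqI[of _ _ t] image_eqI[of _ _ "- t"])
  next
    fix z assume "z \<in> complex_of_real ` {-1<..<1}"
    then obtain x where x: "z = of_real x" "-1 < x" "x < 1" by auto
    then have "z \<in> star 0 {1, -1}"
      unfolding mem_star by (cases "0 \<le> x") (auto intro: bexI[of _ x] bexI[of _ "- x"])
    with x show "z \<in> star 0 {1, -1} \<inter> ball 0 1" by simp
  qed
  then have "connected (star 0 {1, -1} \<inter> ball 0 (1::real))"
    by (auto intro!: connected_continuous_image continuous_intros)
  then have "connected (points L \<inter> U)"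
    unfolding U(4) using U(2)
    by (intro connected_continuous_image) (auto simp: homeomorphism_def intro: continuous_on_subset)
  moreover have "points L \<inter> U \<subseteq> strands L"
    using p U(5) by auto
  ultimately have "points L \<inter> U \<subseteq> connected_component_set (strands L) p"
    using p U(3) by (intro connected_component_maximal) auto
  then have "label L f q = label L f p" if "q \<in> strands L" "q \<in> U" for q
    using that connected_component_eq[of q "strands L" p] by (auto simp: label_def)
  then show "\<forall>\<^sub>F q in at p within strands L. label L f q = label L f p"
    unfolding eventually_at_topological using U(1,3) by blast
qed

lemma component_in_semiarcs: "p \<in> strands L \<Longrightarrow> connected_component_set (strands L) p \<in> semiarcs L"
  by (auto simp: semiarcs_def components_def)

lemma labeling_point_labeling:
  assumes "marked_vertex_diagram L" "labeling X up lo L f"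
  shows "point_labeling X up lo L (label L f)"
proof -
  have X: "label L f p \<in> X" if "p \<in> strands L" for p
    using assms(2) component_in_semiarcs[OF that] by (auto simp: labeling_def label_def)
  note rules = assms(2)[unfolded labeling_def]
  note crossing_rule = rules[THEN conjunct2, THEN conjunct1]
    and saddle_rule = rules[THEN conjunct2, THEN conjunct2]
  show ?thesis
    unfolding point_labeling_def
  proof (intro conjI ballI allI impI)
    show "locally_constant (strands L) (label L f)"
      by (rule label_locally_constant[OF assms(1)])
  next
    fix v k assume v: "v \<in> crossings L" "crossing_param L v k"
    have "label L f (k (- \<i> / 2)) = up (label L f (k (\<i> / 2))) (label L f (k (1 / 2))) \<and>
        label L f (k (- 1 / 2)) = lo (label L f (k (1 / 2))) (label L f (k (\<i> / 2)))"
      by (rule crossing_rule[rule_format, OF v]) simp_all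
    moreover have "label L f (k (\<i> / 2)) \<in> X" "label L f (k (1 / 2)) \<in> X"
      by (intro X half_arm_in_strands[OF crossing_local_param[OF v(2)]]; simp add: mem_directions)+
    ultimately show "crossing_labels X up lo (label L f (k (\<i> / 2))) (label L f (k (- \<i> / 2)))
        (label L f (k (1 / 2))) (label L f (k (- 1 / 2)))"
      unfolding crossing_labels_def by blast
  next
    fix v k and d d' :: complex
    assume "v \<in> saddles L" "saddle_param L v k" "d \<in> directions" "d' \<in> directions"
    then show "label L f (k (d / 2)) = label L f (k (d' / 2))"
      by (intro saddle_rule[rule_format]) (simp_all add: directions_def)
  qed (use X in blast)
qed

text \<open>
  Conversely, a locally constant function is constant on every semiarc, so its value at any point of
  a semiarc may serve as the label.
\<close>
lemma point_labeling_labeling: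
  assumes "bikei X up lo" "point_labeling X up lo L G"
  obtains f where "labeling X up lo L f" "\<And>p. p \<in> strands L \<Longrightarrow> label L f p = G p"
proof -
  note rules = assms(2)[unfolded point_labeling_def]
  note crossing_rule = rules[THEN conjunct2, THEN conjunct2, THEN conjunct1]
    and saddle_rule = rules[THEN conjunct2, THEN conjunct2, THEN conjunct2]
  have X: "G p \<in> X" if "p \<in> strands L" for p
    using rules that by blast
  define f where "f = (\<lambda>C\<in>semiarcs L. G (SOME p. p \<in> C))"
  have label: "label L f p = G p" if p: "p \<in> strands L" for p
  proof -
    let ?C = "connected_component_set (strands L) p"
    have "(SOME q. q \<in> ?C) \<in> ?C"
      by (rule someI[of _ p]) (use p in simp)
    then have "G (SOME q. q \<in> ?C) = G p"
      by (intro locally_constant_connected[of "strands L" G ?C p])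
        (use rules p connected_component_subset in auto)
    then show ?thesis
      using component_in_semiarcs[OF p] by (simp add: label_def f_def)
  qed
  have f_X: "f C \<in> X" if C: "C \<in> semiarcs L" for C
  proof -
    obtain p where "p \<in> strands L" "C = connected_component_set (strands L) p"
      using C by (auto simp: semiarcs_def components_def)
    then show ?thesis
      using label[of p] X[of p] by (simp add: label_def)
  qed
  have "labeling X up lo L f"
    unfolding labeling_def
  proof (intro conjI ballI allI impI)
    show "f \<in> semiarcs L \<rightarrow>\<^sub>E X" using f_X by (auto simp: f_def)
  next
    fix v k and u w :: complex
    assume v: "v \<in> crossings L" "crossing_param L v k" and u: "u \<in> {\<i>, -\<i>}" and w: "w \<in> {1, -1}"
    have "crossing_labels X up lo (G (k (\<i> / 2))) (G (k (-\<i> / 2))) (G (k (1 / 2))) (G (k (-1 / 2)))"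
      by (rule crossing_rule[rule_format, OF v])
    note c = this bikei.crossing_labels_flip_under[OF assms(1) this]
    note c = c c[THEN bikei.crossing_labels_flip_over[OF assms(1)]]
    have "crossing_labels X up lo (G (k (u / 2))) (G (k (- u / 2))) (G (k (w / 2))) (G (k (- w / 2)))"
      using u w c by (elim insertE emptyE) simp_all
    moreover have at_end: "label L f (k (d / 2)) = G (k (d / 2))" if "d \<in> directions" for d
      by (rule label half_arm_in_strands[OF crossing_local_param[OF v(2)] that])+
    have "u \<in> directions" "- u \<in> directions" "w \<in> directions" "- w \<in> directions"
      using u w by (auto simp: mem_directions)
    note this[THEN at_end]
    ultimately show "label L f (k (- u / 2)) = up (label L f (k (u / 2))) (label L f (k (w / 2)))"
      "label L f (k (- w / 2)) = lo (label L f (k (w / 2))) (label L f (k (u / 2)))"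
      by (simp_all add: crossing_labels_def)
  next
    fix v k and d d' :: complex
    assume v: "v \<in> saddles L" "saddle_param L v k"
      and "d \<in> {1, \<i>, -1, -\<i>}" "d' \<in> {1, \<i>, -1, -\<i>}"
    then have d: "d \<in> directions" "d' \<in> directions"
      by (simp_all add: directions_def)
    show "label L f (k (d / 2)) = label L f (k (d' / 2))"
      using d label half_arm_in_strands[OF saddle_local_param[OF v(2)]] saddle_rule[rule_format, OF v d]
      by metis
  qed
  then show thesis using that label by blast
qed

lemma labeling_ext:
  assumes "labeling X up lo L f" "labeling X up lo L f'"
    and "\<And>p. p \<in> strands L \<Longrightarrow> label L f p = label L f' p"
  shows "f = f'"
proof (rule PiE_ext)
  show "f \<in> semiarcs L \<rightarrow>\<^sub>E X" "f' \<in> semiarcs L \<rightarrow>\<^sub>E X"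
    using assms by (auto simp: labeling_def)
  show "f C = f' C" if "C \<in> semiarcs L" for C
    using that assms(3) by (auto simp: semiarcs_def components_def label_def)
qed

text \<open>
  The labeling condition for one parametrization at a crossing implies it for all others. A
  permutation of the arms that keeps the over-strand can only interchange the two over-arms or the two
  under-arms, and both leave \<^const>\<open>crossing_labels\<close> unchanged.
\<close>
lemma crossing_labels_param:
  assumes "bikei X up lo" and k: "crossing_param L v k" and k': "crossing_param L' v k'"
    and W: "open W" "v \<in> W" "points L \<inter> W = points L' \<inter> W" and over: "over L v = over L' v"
    and G: "locally_constant (strands L) G" "locally_constant (strands L') G'"
    and eq: "\<And>p. p \<in> strands L \<inter> W \<Longrightarrow> G p = G' p"
    and labels: "crossing_labels X up lo (G (k (\<i> / 2))) (G (k (-\<i> / 2))) (G (k (1 / 2))) (G (k (-1 / 2)))"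
  shows "crossing_labels X up lo (G' (k' (\<i> / 2))) (G' (k' (-\<i> / 2))) (G' (k' (1 / 2))) (G' (k' (-1 / 2)))"
proof -
  obtain \<sigma> where \<sigma>: "bij_betw \<sigma> directions directions"
    "\<And>d. d \<in> directions \<Longrightarrow> G (k (d / 2)) = G' (k' (\<sigma> d / 2))"
    "filtermap k (at 0 within star 0 {1, -1}) = filtermap k' (at 0 within star 0 {1, -1}) \<Longrightarrow>
       \<forall>d\<in>{1, -1}. \<sigma> d \<in> {1, -1}"
    using labels_match[OF crossing_local_param[OF k] crossing_local_param[OF k'] W G eq] by metis
  have neq: "\<sigma> d \<noteq> \<sigma> d'" if "d \<noteq> d'" "d \<in> directions" "d' \<in> directions" for d d'
    using that bij_betw_imp_inj_on[OF \<sigma>(1)] by (meson inj_onD)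
  have "\<sigma> 1 \<in> {1, -1}" "\<sigma> (-1) \<in> {1, -1}"
    using \<sigma>(3) k k' over by (auto simp: crossing_param_def)
  moreover have "\<sigma> (-1) \<noteq> \<sigma> 1" "\<sigma> \<i> \<noteq> \<sigma> (-\<i>)" "\<sigma> \<i> \<noteq> \<sigma> 1" "\<sigma> \<i> \<noteq> \<sigma> (-1)"
    "\<sigma> (-\<i>) \<noteq> \<sigma> 1" "\<sigma> (-\<i>) \<noteq> \<sigma> (-1)"
    by (rule neq; simp add: mem_directions complex_eq_iff)+
  moreover have "\<sigma> \<i> \<in> directions" "\<sigma> (-\<i>) \<in> directions"
    using bij_betwE[OF \<sigma>(1)] by (simp_all add: mem_directions)
  ultimately have \<sigma>_cases: "(\<sigma> 1 = 1 \<and> \<sigma> (-1) = -1 \<or> \<sigma> 1 = -1 \<and> \<sigma> (-1) = 1) \<and>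
      (\<sigma> \<i> = \<i> \<and> \<sigma> (-\<i>) = -\<i> \<or> \<sigma> \<i> = -\<i> \<and> \<sigma> (-\<i>) = \<i>)"
    unfolding mem_directions insert_iff empty_iff by metis
  have "crossing_labels X up lo (G' (k' (\<sigma> \<i> / 2))) (G' (k' (\<sigma> (-\<i>) / 2)))
      (G' (k' (\<sigma> 1 / 2))) (G' (k' (\<sigma> (-1) / 2)))"
    using labels \<sigma>(2)[of \<i>] \<sigma>(2)[of "-\<i>"] \<sigma>(2)[of 1] \<sigma>(2)[of "-1"] by (simp add: mem_directions)
  note c = this bikei.crossing_labels_flip_under[OF assms(1) this]
  note c = c c[THEN bikei.crossing_labels_flip_over[OF assms(1)]]
  show ?thesis
    using \<sigma>_cases c by (elim conjE disjE) simp_all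
qed

lemma saddle_labels_param:
  assumes k: "saddle_param L v k" and k': "saddle_param L' v k'"
    and W: "open W" "v \<in> W" "points L \<inter> W = points L' \<inter> W"
    and G: "locally_constant (strands L) G" "locally_constant (strands L') G'"
    and eq: "\<And>p. p \<in> strands L \<inter> W \<Longrightarrow> G p = G' p"
    and labels: "\<And>d d'. d \<in> directions \<Longrightarrow> d' \<in> directions \<Longrightarrow> G (k (d / 2)) = G (k (d' / 2))"
    and d: "d \<in> directions" "d' \<in> directions"
  shows "G' (k' (d / 2)) = G' (k' (d' / 2))"
proof -
  obtain \<sigma> where \<sigma>: "bij_betw \<sigma> directions directions"
    "\<And>d. d \<in> directions \<Longrightarrow> G (k (d / 2)) = G' (k' (\<sigma> d / 2))"
    "filtermap k (at 0 within star 0 {1, -1}) = filtermap k' (at 0 within star 0 {1, -1}) \<Longrightarrow>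
       \<forall>d\<in>{1, -1}. \<sigma> d \<in> {1, -1}"
    using labels_match[OF saddle_local_param[OF k] saddle_local_param[OF k'] W G eq] by metis
  note surj = bij_betw_imp_surj_on[OF \<sigma>(1)]
  obtain e where e: "e \<in> directions" "d = \<sigma> e"
    using d(1) surj by (metis imageE)
  obtain e' where e': "e' \<in> directions" "d' = \<sigma> e'"
    using d(2) surj by (metis imageE)
  show ?thesis
    unfolding e(2) e'(2) \<sigma>(2)[OF e(1), symmetric] \<sigma>(2)[OF e'(1), symmetric]
    by (rule labels[OF e(1) e'(1)])
qed

section \<open>The geometry of mosaics\<close>

text \<open>
  The point of the plane with the given lattice coordinates, for the position of mosaics fixed by
  \<^const>\<open>centre\<close>.
\<close>
definition grid :: "nat \<times> nat \<Rightarrow> complex" where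
  "grid e = Complex (real (snd e) - 1) (1 - real (fst e))"

definition end_of :: "nat \<Rightarrow> nat \<Rightarrow> nat \<times> nat \<Rightarrow> nat \<times> nat" where
  "end_of i j q = (2 * i + fst q, 2 * j + snd q)"

definition vertex_tiles :: "tile set" where
  "vertex_tiles = {XH, XV, ME, MW}"

definition arm :: "nat \<Rightarrow> nat \<Rightarrow> nat \<times> nat \<Rightarrow> real \<Rightarrow> complex" where
  "arm i j q t = centre i j + of_real t * grid q"

lemma inj_grid: "inj grid"
  by (auto simp: inj_def grid_def)

lemma grid_simps [simp]:
  "grid (0, Suc 0) = \<i>" "grid (Suc 0, 2) = 1" "grid (2, Suc 0) = -\<i>" "grid (Suc 0, 0) = -1"
  by (simp_all add: grid_def complex_eq_iff)

lemma arms_eq: "arms t = grid ` ports t"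
  by (cases t) auto

lemma grid_end_of: "grid (end_of i j q) = arm i j q 1"
  by (simp add: grid_def end_of_def arm_def centre_def complex_eq_iff)

lemma port_direction: "q \<in> ports t \<Longrightarrow> grid q \<in> directions"
  by (cases t) (auto simp: mem_directions)

lemma port_cases: "q \<in> ports t \<Longrightarrow> q = north \<or> q = east \<or> q = south \<or> q = west"
  by (cases t) auto

lemma vertex_ports: "t \<in> vertex_tiles \<Longrightarrow> ports t = {north, east, south, west}"
  by (auto simp: vertex_tiles_def)

lemma ends_eq: "ends T = {end_of i j q | i j q. i < length T \<and> j < length (T ! i) \<and> q \<in> ports (T ! i ! j)}"
  by (force simp: ends_def end_of_def)

lemma mosaic_labelingD:
  assumes "mosaic_labeling X up lo T m" "i < length T" "j < length (T ! i)"
  shows "tile_rule X up lo (T ! i ! j) (\<lambda>q. m (end_of i j q))"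
  using assms by (auto simp: mosaic_labeling_def end_of_def case_prod_unfold)

lemma mosaic_labelingI:
  assumes "\<And>i j. i < length T \<Longrightarrow> j < length (T ! i) \<Longrightarrow>
    tile_rule X up lo (T ! i ! j) (\<lambda>q. m (end_of i j q))"
  shows "mosaic_labeling X up lo T m"
  using assms by (auto simp: mosaic_labeling_def end_of_def case_prod_unfold)

lemma cmod_arm: "grid q \<in> directions \<Longrightarrow> 0 \<le> t \<Longrightarrow> cmod (of_real t * grid q) = t"
  by (simp add: norm_mult norm_direction)

text \<open>
  Centres of different tiles are at distance at least 2, so two arms of different tiles meet at most in
  the ends of both.
\<close>
lemma arm_unique:
  assumes q: "grid q \<in> directions" "grid q' \<in> directions"
    and t: "0 \<le> t" "t \<le> 1" "0 \<le> t'" "t' \<le> 1"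
    and eq: "arm i j q t = arm i' j' q' t'" and inner: "t < 1 \<or> t' < 1"
  shows "i = i' \<and> j = j' \<and> t = t' \<and> (t = 0 \<or> q = q')"
proof -
  have diff: "centre i j - centre i' j' = of_real t' * grid q' - of_real t * grid q"
    using eq by (simp add: arm_def algebra_simps)
  have "cmod (centre i j - centre i' j') \<le> cmod (of_real t' * grid q') + cmod (of_real t * grid q)"
    unfolding diff by (rule norm_triangle_ineq4)
  also have "\<dots> < 2"
    using cmod_arm[OF q(1) t(1)] cmod_arm[OF q(2) t(3)] t inner by auto
  finally have "\<bar>Re (centre i j - centre i' j')\<bar> < 2" "\<bar>Im (centre i j - centre i' j')\<bar> < 2"
    using abs_Re_le_cmod abs_Im_le_cmod by (metis le_less_trans)+
  then have ij: "i = i'" "j = j'"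
    by (auto simp: centre_def)
  then have eq': "of_real t * grid q = of_real t' * grid q'"
    using diff by simp
  then have "t = t'"
    using cmod_arm[OF q(1) t(1)] cmod_arm[OF q(2) t(3)] by simp
  with eq' have "t = 0 \<or> grid q = grid q'"
    by auto
  then show ?thesis
    using ij \<open>t = t'\<close> inj_grid by (auto dest: injD)
qed

definition occupied :: "mosaic \<Rightarrow> nat \<Rightarrow> nat \<Rightarrow> nat \<times> nat \<Rightarrow> real \<Rightarrow> bool" where
  "occupied T i j q t \<longleftrightarrow> i < length T \<and> j < length (T ! i) \<and> q \<in> ports (T ! i ! j) \<and> 0 \<le> t \<and> t \<le> 1"

definition on_strand :: "mosaic \<Rightarrow> nat \<Rightarrow> nat \<Rightarrow> nat \<times> nat \<Rightarrow> real \<Rightarrow> bool" where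
  "on_strand T i j q t \<longleftrightarrow> occupied T i j q t \<and> (0 < t \<or> T ! i ! j \<notin> vertex_tiles)"

lemma mem_mosaic_points: "p \<in> mosaic_points T \<longleftrightarrow> (\<exists>i j q t. occupied T i j q t \<and> p = arm i j q t)"
  by (fastforce simp: mosaic_points_def mem_star arms_eq occupied_def arm_def)

text \<open>
  A labeling of lattice points, spread along the arms. The choice is immaterial by \<open>paint_arm\<close>.
\<close>
definition paint :: "mosaic \<Rightarrow> (nat \<times> nat \<Rightarrow> 'a) \<Rightarrow> complex \<Rightarrow> 'a" where
  "paint T m p = m (SOME e. \<exists>i j q t. on_strand T i j q t \<and> p = arm i j q t \<and> e = end_of i j q)"

lemma tile_rule_arc:
  assumes "tile_rule X up lo t m" "t \<notin> vertex_tiles" "q \<in> ports t" "q' \<in> ports t"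
  shows "m q = m q'"
  using assms by (cases t) (auto simp: vertex_tiles_def)

lemma on_strandD:
  assumes "on_strand T i j q t"
  shows "i < length T" "j < length (T ! i)" "q \<in> ports (T ! i ! j)" "grid q \<in> directions" "0 \<le> t" "t \<le> 1"
proof -
  show "q \<in> ports (T ! i ! j)"
    using assms by (simp add: on_strand_def occupied_def)
  then show "grid q \<in> directions"
    by (rule port_direction)
qed (use assms in \<open>simp_all add: on_strand_def occupied_def\<close>)

text \<open>
  A point lies on several arms only if it is the common end of two of them, which is a single lattice
  point, or the centre of an arc tile, whose two ends have equal labels.
\<close>
lemma paint_arm:
  assumes m: "mosaic_labeling X up lo T m" and s: "on_strand T i j q t"
  shows "paint T m (arm i j q t) = m (end_of i j q)"
proof -
  have "m e = m (end_of i j q)"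
    if e: "\<exists>i' j' q' t'. on_strand T i' j' q' t' \<and> arm i j q t = arm i' j' q' t' \<and> e = end_of i' j' q'" for e
  proof -
    obtain i' j' q' t' where s': "on_strand T i' j' q' t'" "arm i j q t = arm i' j' q' t'" "e = end_of i' j' q'"
      using e by blast
    note d = on_strandD[OF s] and d' = on_strandD[OF s'(1)]
    show ?thesis
    proof (cases "t < 1 \<or> t' < 1")
      case True
      note u = arm_unique[OF d(4) d'(4) d(5,6) d'(5,6) s'(2) True]
      show ?thesis
      proof (cases "t = 0")
        case True
        then have "T ! i ! j \<notin> vertex_tiles" using s by (simp add: on_strand_def)
        then show ?thesis
          using tile_rule_arc[OF mosaic_labelingD[OF m d(1,2)]] d(3) d'(3) u s'(3) by metis
      qed (use u s'(3) in auto)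
    next
      case False
      then have "grid (end_of i j q) = grid (end_of i' j' q')"
        using s'(2) d(6) d'(6) unfolding grid_end_of by (metis antisym_conv2 order_le_less)
      then show ?thesis using s'(3) injD[OF inj_grid] by metis
    qed
  qed
  moreover have "\<exists>e i' j' q' t'. on_strand T i' j' q' t' \<and> arm i j q t = arm i' j' q' t' \<and> e = end_of i' j' q'"
    using s by blast
  ultimately show ?thesis
    unfolding paint_def by (rule someI2_ex[rotated])
qed

lemma rectangularD:
  assumes "rectangular T" "i < length T"
  shows "length (T ! i) = length (hd T)"
  using assms nth_mem unfolding rectangular_def by blast

lemma mem_rectangle: "z \<in> rectangle T \<longleftrightarrow>
    -1 \<le> Re z \<and> Re z \<le> 2 * real (length (hd T)) - 1 \<and> 1 - 2 * real (length T) \<le> Im z \<and> Im z \<le> 1"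
  by (auto simp: rectangle_def in_cbox_complex_iff)

lemma cball_tile_in_rectangle:
  assumes "rectangular T" "i < length T" "j < length (T ! i)" "cmod (z - centre i j) \<le> 1"
  shows "z \<in> rectangle T"
proof -
  have "\<bar>Re (z - centre i j)\<bar> \<le> 1" "\<bar>Im (z - centre i j)\<bar> \<le> 1"
    using abs_Re_le_cmod abs_Im_le_cmod assms(4) order_trans by blast+
  moreover have "real i + 1 \<le> length T" "real j + 1 \<le> length (hd T)"
    using assms(2,3) rectangularD[OF assms(1,2)] by linarith+
  ultimately show ?thesis
    by (auto simp: mem_rectangle centre_def)
qed

lemma arm_in_rectangle:
  assumes "rectangular T" "occupied T i j q t"
  shows "arm i j q t \<in> rectangle T"
proof (rule cball_tile_in_rectangle[OF assms(1), of i j])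
  show "cmod (arm i j q t - centre i j) \<le> 1"
    using assms(2) cmod_arm[OF port_direction[of q "T ! i ! j"], of t] by (simp add: occupied_def arm_def)
qed (use assms(2) in \<open>simp_all add: occupied_def\<close>)

text \<open>
  Every point of an arm other than its end lies in the open unit disk around the centre of the tile,
  hence in the interior of the rectangle.
\<close>
lemma arm_on_frontier:
  assumes "rectangular T" "occupied T i j q t" "arm i j q t \<notin> interior (rectangle T)"
  shows "t = 1 \<and> end_of i j q \<in> ends T \<inter> rim T"
proof -
  have ij: "i < length T" "j < length (T ! i)" "q \<in> ports (T ! i ! j)" "0 \<le> t" "t \<le> 1"
    using assms(2) by (auto simp: occupied_def)
  define m n where "m = length T" and "n = length (hd T)"
  have b: "real i + 1 \<le> m" "real j + 1 \<le> n"
    using ij rectangularD[OF assms(1) ij(1)] unfolding m_def n_def by linarith+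
  let ?p = "arm i j q t"
  have frontier: "\<not> (-1 < Re ?p \<and> Re ?p < 2 * real n - 1 \<and> 1 - 2 * real m < Im ?p \<and> Im ?p < 1)"
    using assms(3) by (simp add: rectangle_def in_box_complex_iff m_def n_def)
  from port_cases[OF ij(3)] have "t = 1 \<and> end_of i j q \<in> rim T"
  proof (elim disjE)
    assume q: "q = north"
    have "Re ?p = 2 * real j" "Im ?p = t - 2 * real i"
      by (simp_all add: q arm_def centre_def)
    with frontier b ij(4,5) have "t = 1 \<and> real i = 0" by linarith
    then show ?thesis by (simp add: q end_of_def rim_def)
  next
    assume q: "q = east"
    have "Re ?p = 2 * real j + t" "Im ?p = - 2 * real i"
      by (simp_all add: q arm_def centre_def)
    with frontier b ij(4,5) have "t = 1 \<and> real j + 1 = real n" by linarith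
    then have "t = 1" "n = Suc j" by linarith+
    then show ?thesis by (simp add: q end_of_def rim_def n_def)
  next
    assume q: "q = south"
    have "Re ?p = 2 * real j" "Im ?p = - 2 * real i - t"
      by (simp_all add: q arm_def centre_def)
    with frontier b ij(4,5) have "t = 1 \<and> real i + 1 = real m" by linarith
    then have "t = 1" "m = Suc i" by linarith+
    then show ?thesis by (simp add: q end_of_def rim_def m_def)
  next
    assume q: "q = west"
    have "Re ?p = 2 * real j - t" "Im ?p = - 2 * real i"
      by (simp_all add: q arm_def centre_def)
    with frontier b ij(4,5) have "t = 1 \<and> real j = 0" by linarith
    then show ?thesis by (simp add: q end_of_def rim_def)
  qed
  then show ?thesis using ij(1-3) unfolding ends_eq by blast
qed

text \<open>
  Behind the rim there is no second tile.
\<close>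
lemma rim_end_unique:
  assumes "rectangular T" "occupied T i j q 1" "occupied T i' j' q' 1"
    and "end_of i j q = end_of i' j' q'" "end_of i j q \<in> rim T"
  shows "i = i' \<and> j = j' \<and> q = q'"
proof -
  have b: "i < length T" "j < length (hd T)" "i' < length T" "j' < length (hd T)"
    and p: "q \<in> ports (T ! i ! j)" "q' \<in> ports (T ! i' ! j')"
    using assms(2,3) rectangularD[OF assms(1)] by (auto simp: occupied_def)
  show ?thesis
    using port_cases[OF p(1)] port_cases[OF p(2)] b assms(4,5)
    by (elim disjE; simp add: end_of_def rim_def; presburger)
qed

section \<open>Mosaics inside a diagram\<close>

locale depicted =
  fixes T :: mosaic and B :: "complex set" and h g :: "complex \<Rightarrow> complex" and L :: diagram
  assumes rect: "rectangular T"
    and homeo: "homeomorphism (rectangle T) B h g"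
    and dep: "depicts h T L"
begin

lemma h_in_B: "z \<in> rectangle T \<Longrightarrow> h z \<in> B"
  using homeo by (auto simp: homeomorphism_def)

lemma g_h: "z \<in> rectangle T \<Longrightarrow> g (h z) = z"
  using homeo by (auto simp: homeomorphism_def)

lemma h_cont: "continuous_on (rectangle T) h"
  using homeo by (auto simp: homeomorphism_def)

lemma g_cont: "continuous_on B g"
  using homeo by (auto simp: homeomorphism_def)

lemma h_image: "h ` rectangle T = B"
  using homeo by (auto simp: homeomorphism_def)

lemma inj_h: "inj_on h (rectangle T)"
  by (rule inj_on_inverseI[of _ g]) (rule g_h)

lemma compact_B: "compact B"
  using compact_continuous_image[OF h_cont] h_image by (simp add: rectangle_def)

text \<open>
  Invariance of domain. In particular the interior of the rectangle is mapped into the interior of \<open>B\<close>,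
  and points of the diagram outside \<open>B\<close> can accumulate in \<open>B\<close> only at the image of the frontier.
\<close>
lemma open_image: "open S \<Longrightarrow> S \<subseteq> rectangle T \<Longrightarrow> open (h ` S)"
  by (intro invariance_of_domain continuous_on_subset[OF h_cont] inj_on_subset[OF inj_h])

lemma tile_ball_in_rectangle:
  "i < length T \<Longrightarrow> j < length (T ! i) \<Longrightarrow> ball (centre i j) 1 \<subseteq> rectangle T"
  using cball_tile_in_rectangle[OF rect, of i j] by (auto simp: dist_norm norm_minus_commute)

lemma points_iff: "x \<in> points L \<inter> B \<longleftrightarrow> (\<exists>i j q t. occupied T i j q t \<and> x = h (arm i j q t))"
proof -
  have "points L \<inter> B = h ` mosaic_points T"
    using dep h_image by (simp add: depicts_def)
  then have "x \<in> points L \<inter> B \<longleftrightarrow> (\<exists>p. p \<in> mosaic_points T \<and> x = h p)"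
    by auto
  then show ?thesis
    unfolding mem_mosaic_points by blast
qed

lemma vertices_iff: "x \<in> vertices L \<inter> B \<longleftrightarrow>
    (\<exists>i j. i < length T \<and> j < length (T ! i) \<and> T ! i ! j \<in> vertex_tiles \<and> x = h (centre i j))"
proof -
  have "vertices L \<inter> B = h ` tile_centres T {XH, XV} \<union> h ` tile_centres T {ME, MW}"
    using dep h_image by (simp add: depicts_def vertices_def Int_Un_distrib2)
  also have "\<dots> = h ` tile_centres T vertex_tiles"
    unfolding image_Un[symmetric] by (rule arg_cong[of _ _ "image h"]) (auto simp: tile_centres_def vertex_tiles_def)
  finally show ?thesis
    unfolding tile_centres_def by blast
qed

lemma strand_iff: "x \<in> strands L \<inter> B \<longleftrightarrow> (\<exists>i j q t. on_strand T i j q t \<and> x = h (arm i j q t))"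
proof
  assume x: "x \<in> strands L \<inter> B"
  then obtain i j q t where o: "occupied T i j q t" "x = h (arm i j q t)"
    using points_iff by blast
  have "0 < t \<or> T ! i ! j \<notin> vertex_tiles"
  proof (rule ccontr)
    assume "\<not> ?thesis"
    then have "t = 0" "T ! i ! j \<in> vertex_tiles" using o(1) by (auto simp: occupied_def)
    then have "x \<in> vertices L \<inter> B"
      unfolding vertices_iff using o by (auto simp: arm_def occupied_def)
    with x show False by blast
  qed
  then show "\<exists>i j q t. on_strand T i j q t \<and> x = h (arm i j q t)"
    using o unfolding on_strand_def by blast
next
  assume "\<exists>i j q t. on_strand T i j q t \<and> x = h (arm i j q t)"
  then obtain i j q t where s: "on_strand T i j q t" and x: "x = h (arm i j q t)"
    by blast
  have occ: "occupied T i j q t" using s by (simp add: on_strand_def)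
  then have "x \<in> points L \<inter> B" unfolding points_iff x by blast
  moreover have "x \<notin> vertices L"
  proof
    assume "x \<in> vertices L"
    then have "x \<in> vertices L \<inter> B" using calculation by blast
    then obtain i' j' where v: "i' < length T" "j' < length (T ! i')" "T ! i' ! j' \<in> vertex_tiles"
      "x = h (centre i' j')" unfolding vertices_iff by blast
    have c: "centre i' j' = arm i' j' north 0" by (simp add: arm_def)
    have occ': "occupied T i' j' north 0" using v by (simp add: occupied_def vertex_ports)
    have "arm i j q t = arm i' j' north 0"
      using inj_onD[OF inj_h, of "arm i j q t" "arm i' j' north 0"] v(4) x c
        arm_in_rectangle[OF rect occ] arm_in_rectangle[OF rect occ'] by simp
    then have "i = i' \<and> j = j' \<and> t = 0"
      using arm_unique[of q north t 0 i j i' j'] on_strandD[OF s] by (auto simp: mem_directions)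
    then show False using s v(3) by (auto simp: on_strand_def)
  qed
  ultimately show "x \<in> strands L \<inter> B" by blast
qed

lemma constant_on_arm:
  assumes "locally_constant (strands L) G" "on_strand T i j q t"
  shows "G (h (arm i j q t)) = G (h (grid (end_of i j q)))"
proof -
  let ?C = "(\<lambda>s. h (arm i j q s)) ` {t..1}"
  have on: "on_strand T i j q s" if "s \<in> {t..1}" for s
    using assms(2) that by (auto simp: on_strand_def occupied_def)
  have "continuous_on {t..1} (\<lambda>s. h (arm i j q s))"
  proof (rule continuous_on_compose2[OF h_cont])
    show "continuous_on {t..1} (arm i j q)"
      unfolding arm_def by (intro continuous_intros)
    show "arm i j q ` {t..1} \<subseteq> rectangle T"
      by (intro image_subsetI arm_in_rectangle[OF rect]) (use on in \<open>simp add: on_strand_def\<close>)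
  qed
  then have "connected ?C"
    by (intro connected_continuous_image) auto
  moreover have "?C \<subseteq> strands L"
    using strand_iff on by blast
  ultimately show ?thesis
    unfolding grid_end_of
    by (rule locally_constant_connected[OF assms(1)]) (use on_strandD[OF assms(2)] in auto)
qed

lemma constant_on_arc:
  assumes "locally_constant (strands L) G" "i < length T" "j < length (T ! i)"
    and "T ! i ! j \<notin> vertex_tiles" "q \<in> ports (T ! i ! j)" "q' \<in> ports (T ! i ! j)"
  shows "G (h (grid (end_of i j q))) = G (h (grid (end_of i j q')))"
  using constant_on_arm[OF assms(1), of i j q 0] constant_on_arm[OF assms(1), of i j q' 0] assms(2-)
  by (simp add: on_strand_def occupied_def arm_def)

end

lemma star_affine: "star c ((*) a ` A) = (\<lambda>z. c + a * z) ` star 0 A"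
proof (intro set_eqI iffI)
  fix p assume "p \<in> star c ((*) a ` A)"
  then obtain d t where d: "d \<in> A" "t \<in> {0..1}" "p = c + of_real t * (a * d)"
    unfolding mem_star by blast
  have "of_real t * d \<in> star 0 A"
    unfolding mem_star using d by (intro bexI[of _ d] bexI[of _ t]) simp_all
  then show "p \<in> (\<lambda>z. c + a * z) ` star 0 A"
    by (rule rev_image_eqI) (simp add: d(3))
next
  fix p assume "p \<in> (\<lambda>z. c + a * z) ` star 0 A"
  then obtain z where z: "z \<in> star 0 A" "p = c + a * z"
    by blast
  then obtain d t where d: "d \<in> A" "t \<in> {0..1}" "z = 0 + of_real t * d"
    unfolding mem_star by blast
  then show "p \<in> star c ((*) a ` A)"
    unfolding mem_star using z(2) by (intro bexI[of _ "a * d"] bexI[of _ t] imageI) simp_all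
qed

lemma filtermap_affine_star:
  assumes "cmod a = 1"
  shows "filtermap (\<lambda>z. c + a * z) (at 0 within star 0 A) = at c within star c ((*) a ` A)"
proof -
  have "a \<noteq> 0" using assms by auto
  then show ?thesis
    unfolding filter_eq_iff eventually_filtermap eventually_at star_affine
    using assms by (simp add: dist_norm norm_mult)
qed

lemma tile_rule_arcI:
  assumes "t \<notin> vertex_tiles" "\<And>q. q \<in> ports t \<Longrightarrow> m q \<in> X"
    and "\<And>q q'. q \<in> ports t \<Longrightarrow> q' \<in> ports t \<Longrightarrow> m q = m q'"
  shows "tile_rule X up lo t m"
proof (cases "t = Em")
  case False
  then obtain q where q: "q \<in> ports t" by (cases t) auto
  have "\<forall>q'\<in>ports t. m q' = m q" "m q \<in> X"
    using assms(2,3) q by blast+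
  then show ?thesis
    using assms(1) by (cases t) (simp_all add: vertex_tiles_def)
qed simp

lemma occupied_direction: "occupied T i j q t \<Longrightarrow> grid q \<in> directions"
  using port_direction[of q "T ! i ! j"] by (simp add: occupied_def)

context depicted begin

lemma arm_inj:
  assumes "occupied T i j q t" "occupied T i' j' q' t'" "h (arm i j q t) = h (arm i' j' q' t')"
  shows "arm i j q t = arm i' j' q' t'"
  by (rule inj_onD[OF inj_h assms(3)]) (rule arm_in_rectangle[OF rect assms(1)] arm_in_rectangle[OF rect assms(2)])+

text \<open>
  The factor \<open>a\<close> allows a quarter turn, which brings the tiles \<open>XV\<close> and \<open>MW\<close> into the standard
  position of \<^const>\<open>crossing_param\<close> and \<^const>\<open>saddle_param\<close>.
\<close>
lemma tile_local_param:
  assumes i: "i < length T" "j < length (T ! i)" and v: "T ! i ! j \<in> vertex_tiles" and a: "a \<in> {1, \<i>}"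
  shows "local_param L directions (h (centre i j)) (\<lambda>z. h (centre i j + a * z))"
proof -
  let ?c = "centre i j" and ?k = "\<lambda>z. h (centre i j + a * z)"
  let ?U = "h ` ball ?c 1"
  have norm_a: "cmod a = 1" "a \<noteq> 0" using a by auto
  have rot: "a * d \<in> directions" "d / a \<in> directions" if "d \<in> directions" for d
    using that a by (auto simp: mem_directions)
  have aff: "(\<lambda>z. ?c + a * z) ` ball 0 1 = ball ?c 1"
  proof (intro set_eqI iffI)
    fix w assume "w \<in> ball ?c 1"
    then have "w = ?c + a * ((w - ?c) / a)" "(w - ?c) / a \<in> ball 0 1"
      using norm_a by (simp_all add: dist_norm norm_divide norm_minus_commute)
    then show "w \<in> (\<lambda>z. ?c + a * z) ` ball 0 1" by blast
  qed (use norm_a in \<open>auto simp: dist_norm norm_mult\<close>)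
  note ball = tile_ball_in_rectangle[OF i]
  have "homeomorphism (ball 0 1) ?U ?k (\<lambda>x. (g x - ?c) / a)"
  proof (rule homeomorphismI)
    show "continuous_on (ball 0 1) ?k"
      by (rule continuous_on_compose2[OF h_cont]) (use aff ball in \<open>auto intro!: continuous_intros\<close>)
    show "continuous_on ?U (\<lambda>x. (g x - ?c) / a)"
      by (intro continuous_intros continuous_on_subset[OF g_cont]) (use norm_a ball h_in_B in auto)
    show "?k ` ball 0 1 \<subseteq> ?U" using aff by blast
    show "(\<lambda>x. (g x - ?c) / a) ` ?U \<subseteq> ball 0 1"
      using g_h ball norm_a by (force simp: norm_divide dist_norm norm_minus_commute)
    show "(g (?k z) - ?c) / a = z" if "z \<in> ball 0 1" for z
    proof -
      have "?c + a * z \<in> rectangle T" using aff ball that by blast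
      then show ?thesis using g_h norm_a by simp
    qed
    show "?k ((g x - ?c) / a) = x" if "x \<in> ?U" for x
      using that g_h ball norm_a by auto
  qed
  moreover have "points L \<inter> ?U = ?k ` (star 0 directions \<inter> ball 0 1)"
  proof (intro set_eqI iffI)
    fix x assume x: "x \<in> points L \<inter> ?U"
    then obtain z where z: "z \<in> ball ?c 1" "x = h z" by blast
    then have "x \<in> points L \<inter> B" using x ball h_in_B by blast
    then obtain i' j' q' t' where o: "occupied T i' j' q' t'" "x = h (arm i' j' q' t')"
      unfolding points_iff by blast
    have z_arm: "z = arm i' j' q' t'"
      using inj_onD[OF inj_h, of z] z o ball arm_in_rectangle[OF rect o(1)] by auto
    have q': "grid q' \<in> directions" "0 \<le> t'" "t' \<le> 1"
      using o(1) port_direction[of q' "T ! i' ! j'"] by (simp_all add: occupied_def)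
    \<comment> \<open>Centres of different tiles are too far apart for an arm of another tile to come this close.\<close>
    have "cmod (arm i' j' q' t' - ?c) < 1" using z(1) z_arm by (simp add: dist_norm norm_minus_commute)
    moreover have "cmod (centre i' j' - ?c) \<le> cmod (arm i' j' q' t' - ?c) + cmod (of_real t' * grid q')"
      using norm_triangle_ineq4[of "arm i' j' q' t' - ?c" "of_real t' * grid q'"] by (simp add: arm_def)
    ultimately have "cmod (centre i' j' - ?c) < 2"
      unfolding cmod_arm[OF q'(1,2)] using q'(3) by linarith
    then have "\<bar>Re (centre i' j' - ?c)\<bar> < 2" "\<bar>Im (centre i' j' - ?c)\<bar> < 2"
      using abs_Re_le_cmod abs_Im_le_cmod le_less_trans by blast+
    then have "i' = i" "j' = j" by (auto simp: centre_def)
    then have zc: "z = ?c + of_real t' * grid q'" using z_arm by (simp add: arm_def)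
    let ?w = "of_real t' * (grid q' / a)"
    have "?w \<in> star 0 directions"
      unfolding mem_star using rot(2)[OF q'(1)] q' by (intro bexI[of _ "grid q' / a"] bexI[of _ t']) simp_all
    moreover have "?w \<in> ball 0 1"
      using z(1) norm_a unfolding zc by (simp add: dist_norm norm_mult norm_divide)
    ultimately have "?w \<in> star 0 directions \<inter> ball 0 1" by (rule IntI)
    then show "x \<in> ?k ` (star 0 directions \<inter> ball 0 1)"
      by (rule rev_image_eqI) (use z(2) zc norm_a in simp)
  next
    fix x assume "x \<in> ?k ` (star 0 directions \<inter> ball 0 1)"
    then obtain w where w: "w \<in> star 0 directions" "w \<in> ball 0 1" "x = ?k w" by blast
    then obtain d t where d: "d \<in> directions" "t \<in> {0..1}" "w = 0 + of_real t * d"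
      unfolding mem_star by blast
    have "\<exists>q\<in>ports (T ! i ! j). grid q = a * d"
      using rot(1)[OF d(1)] unfolding vertex_ports[OF v] by (auto simp: mem_directions)
    then obtain q where q: "q \<in> ports (T ! i ! j)" "grid q = a * d" by blast
    then have "x = h (arm i j q t)" using w(3) d(3) by (simp add: arm_def mult.left_commute)
    moreover have "occupied T i j q t" using i q d(2) by (simp add: occupied_def)
    ultimately have "x \<in> points L" using points_iff by blast
    moreover have "x \<in> ?U" using w aff by blast
    ultimately show "x \<in> points L \<inter> ?U" by blast
  qed
  moreover have "vertices L \<inter> ?U \<subseteq> {h ?c}"
  proof
    fix x assume x: "x \<in> vertices L \<inter> ?U"
    then obtain z where z: "z \<in> ball ?c 1" "x = h z" by blast
    then have "x \<in> vertices L \<inter> B" using x ball h_in_B by blast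
    then obtain i' j' where c': "i' < length T" "j' < length (T ! i')" "x = h (centre i' j')"
      unfolding vertices_iff by blast
    have "centre i' j' \<in> rectangle T"
      using tile_ball_in_rectangle[OF c'(1,2)] by auto
    then have "z = centre i' j'"
      using inj_onD[OF inj_h, of z "centre i' j'"] z c' ball by auto
    then have "cmod (centre i' j' - ?c) < 2"
      using z(1) by (simp add: dist_norm norm_minus_commute)
    then have "\<bar>Re (centre i' j' - ?c)\<bar> < 2" "\<bar>Im (centre i' j' - ?c)\<bar> < 2"
      using abs_Re_le_cmod abs_Im_le_cmod le_less_trans by blast+
    then have "i' = i" "j' = j" by (auto simp: centre_def)
    then show "x \<in> {h ?c}" using c'(3) by simp
  qed
  ultimately show ?thesis
    unfolding local_param_def using open_image[OF open_ball ball] by (intro exI conjI) auto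
qed

lemma filtermap_tile:
  assumes "cmod a = 1"
  shows "filtermap (\<lambda>z. h (c + a * z)) (at 0 within star 0 A) = filtermap h (at c within star c ((*) a ` A))"
  unfolding filtermap_affine_star[OF assms, symmetric] filtermap_filtermap ..

lemma centre_in_tile_centres:
  "i < length T \<Longrightarrow> j < length (T ! i) \<Longrightarrow> centre i j \<in> tile_centres T {T ! i ! j}"
  by (auto simp: tile_centres_def)

lemma crossing_param_XH:
  assumes i: "i < length T" "j < length (T ! i)" and v: "T ! i ! j = XH"
  shows "crossing_param L (h (centre i j)) (\<lambda>z. h (centre i j + 1 * z))"
  using tile_local_param[OF i, of 1] dep centre_in_tile_centres[OF i] v
  by (simp add: crossing_param_def filtermap_tile[of 1, simplified] depicts_def vertex_tiles_def directions_def)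

lemma crossing_param_XV:
  assumes i: "i < length T" "j < length (T ! i)" and v: "T ! i ! j = XV"
  shows "crossing_param L (h (centre i j)) (\<lambda>z. h (centre i j + \<i> * z))"
  using tile_local_param[OF i, of "\<i>"] dep centre_in_tile_centres[OF i] v
  by (simp add: crossing_param_def filtermap_tile depicts_def vertex_tiles_def directions_def)

lemma saddle_param_ME:
  assumes i: "i < length T" "j < length (T ! i)" and v: "T ! i ! j = ME"
  shows "saddle_param L (h (centre i j)) (\<lambda>z. h (centre i j + 1 * z))"
  using tile_local_param[OF i, of 1] dep centre_in_tile_centres[OF i] v
  by (simp add: saddle_param_def filtermap_tile[of 1, simplified] depicts_def vertex_tiles_def directions_def)

lemma saddle_param_MW:
  assumes i: "i < length T" "j < length (T ! i)" and v: "T ! i ! j = MW"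
  shows "saddle_param L (h (centre i j)) (\<lambda>z. h (centre i j + \<i> * z))"
  using tile_local_param[OF i, of "\<i>"] dep centre_in_tile_centres[OF i] v
  by (simp add: saddle_param_def filtermap_tile depicts_def vertex_tiles_def directions_def insert_commute)

lemma crossing_param_tile:
  assumes "v \<in> crossings L \<inter> B"
  obtains i j a where "i < length T" "j < length (T ! i)" "v = h (centre i j)"
    "crossing_param L v (\<lambda>z. h (centre i j + a * z))"
    "T ! i ! j = XH \<and> a = 1 \<or> T ! i ! j = XV \<and> a = \<i>"
proof -
  have "v \<in> h ` tile_centres T {XH, XV}"
    using assms dep h_image unfolding depicts_def by blast
  then obtain i j where "i < length T" "j < length (T ! i)" "v = h (centre i j)"
    "T ! i ! j = XH \<or> T ! i ! j = XV"
    unfolding tile_centres_def by blast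
  then show thesis
    using that crossing_param_XH crossing_param_XV by metis
qed

lemma saddle_param_tile:
  assumes "v \<in> saddles L \<inter> B"
  obtains i j a where "i < length T" "j < length (T ! i)" "v = h (centre i j)"
    "saddle_param L v (\<lambda>z. h (centre i j + a * z))"
    "T ! i ! j = ME \<and> a = 1 \<or> T ! i ! j = MW \<and> a = \<i>"
proof -
  have "v \<in> h ` tile_centres T {ME, MW}"
    using assms dep h_image unfolding depicts_def by blast
  then obtain i j where "i < length T" "j < length (T ! i)" "v = h (centre i j)"
    "T ! i ! j = ME \<or> T ! i ! j = MW"
    unfolding tile_centres_def by blast
  then show thesis
    using that saddle_param_ME saddle_param_MW by metis
qed

lemma centre_in_vertices:
  assumes "i < length T" "j < length (T ! i)"
  shows "T ! i ! j \<in> {XH, XV} \<Longrightarrow> h (centre i j) \<in> crossings L"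
    and "T ! i ! j \<in> {ME, MW} \<Longrightarrow> h (centre i j) \<in> saddles L"
proof -
  have "crossings L \<inter> h ` rectangle T = h ` tile_centres T {XH, XV}"
    "saddles L \<inter> h ` rectangle T = h ` tile_centres T {ME, MW}"
    using dep by (simp_all add: depicts_def)
  moreover have "h (centre i j) \<in> h ` tile_centres T K" if "T ! i ! j \<in> K" for K
    using assms that unfolding tile_centres_def by blast
  ultimately show "T ! i ! j \<in> {XH, XV} \<Longrightarrow> h (centre i j) \<in> crossings L"
    "T ! i ! j \<in> {ME, MW} \<Longrightarrow> h (centre i j) \<in> saddles L"
    by (metis IntD1)+
qed

lemma half_arm:
  "centre i j + \<i> / 2 = arm i j north (1/2)" "centre i j - \<i> / 2 = arm i j south (1/2)"
  "centre i j + 1 / 2 = arm i j east (1/2)" "centre i j - 1 / 2 = arm i j west (1/2)"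
  by (simp_all add: arm_def)

lemma constant_on_half_arm:
  assumes "locally_constant (strands L) G" "i < length T" "j < length (T ! i)" "q \<in> ports (T ! i ! j)"
  shows "G (h (arm i j q (1/2))) = G (h (grid (end_of i j q)))"
  by (rule constant_on_arm[OF assms(1)]) (use assms in \<open>simp add: on_strand_def occupied_def\<close>)

lemma end_in_strands: "e \<in> ends T \<Longrightarrow> h (grid e) \<in> strands L \<inter> B"
  unfolding ends_eq
proof (elim CollectE exE conjE)
  fix i j q assume "e = end_of i j q" "i < length T" "j < length (T ! i)" "q \<in> ports (T ! i ! j)"
  then have "on_strand T i j q 1" "h (grid e) = h (arm i j q 1)"
    by (simp_all add: on_strand_def occupied_def grid_end_of)
  then show "h (grid e) \<in> strands L \<inter> B"
    unfolding strand_iff by blast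
qed

text \<open>
  An arm without the vertex in its centre lies in a single semiarc, so the label at its end is the label
  next to the vertex, to which the labeling condition refers.
\<close>
lemma mosaic_labeling_of_point_labeling:
  assumes "bikei X up lo" "point_labeling X up lo L G"
  shows "mosaic_labeling X up lo T (\<lambda>e. G (h (grid e)))"
proof (rule mosaic_labelingI)
  fix i j assume i: "i < length T" "j < length (T ! i)"
  note rules = assms(2)[unfolded point_labeling_def]
  note G_X = rules[THEN conjunct1] and lc = rules[THEN conjunct2, THEN conjunct1]
    and crossing_rule = rules[THEN conjunct2, THEN conjunct2, THEN conjunct1]
    and saddle_rule = rules[THEN conjunct2, THEN conjunct2, THEN conjunct2]
  let ?m = "\<lambda>q. G (h (grid (end_of i j q)))"
  have X: "?m q \<in> X" if "q \<in> ports (T ! i ! j)" for q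
  proof -
    have "end_of i j q \<in> ends T" unfolding ends_eq using i that by blast
    then show ?thesis using end_in_strands G_X by blast
  qed
  have arc: "?m q' = ?m q" if "T ! i ! j \<notin> vertex_tiles" "q \<in> ports (T ! i ! j)" "q' \<in> ports (T ! i ! j)" for q q'
    by (rule constant_on_arc[OF lc i that(1,3,2)])
  note half = constant_on_half_arm[OF lc i]
  show "tile_rule X up lo (T ! i ! j) ?m"
  proof (cases "T ! i ! j \<in> vertex_tiles")
    case False
    then show ?thesis
      using X arc by (intro tile_rule_arcI)
  next
    case True
    then consider (XH) "T ! i ! j = XH" | (XV) "T ! i ! j = XV" | (ME) "T ! i ! j = ME" | (MW) "T ! i ! j = MW"
      by (auto simp: vertex_tiles_def)
    then show ?thesis
    proof cases
      case XH
      have "crossing_labels X up lo (?m north) (?m south) (?m east) (?m west)"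
        using crossing_rule[rule_format, OF centre_in_vertices(1)[OF i] crossing_param_XH[OF i XH]] XH
        by (simp add: half_arm half)
      then show ?thesis
        using bikei.crossing_labels_flip_over[OF assms(1)] XH by simp
    next
      case XV
      then show ?thesis
        using crossing_rule[rule_format, OF centre_in_vertices(1)[OF i] crossing_param_XV[OF i XV]]
        by (simp add: half_arm half)
    next
      case ME
      note eq = saddle_rule[rule_format, OF centre_in_vertices(2)[OF i] saddle_param_ME[OF i ME]]
      show ?thesis
        using ME X[of north] eq[of \<i> 1] eq[of \<i> "-1"] eq[of \<i> "-\<i>"]
        by (simp add: half_arm half mem_directions)
    next
      case MW
      note eq = saddle_rule[rule_format, OF centre_in_vertices(2)[OF i] saddle_param_MW[OF i MW]]
      show ?thesis
        using MW X[of north] eq[of 1 \<i>] eq[of 1 "-1"] eq[of 1 "-\<i>"]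
        by (simp add: half_arm half mem_directions)
    qed
  qed
qed

text \<open>
  The arms are finitely many compact sets, so a point has a neighbourhood that only meets the arms
  on which the point lies.
\<close>
lemma arm_neighbourhood:
  obtains W where "open W" "x \<in> W"
    "\<And>i j q t. occupied T i j q t \<Longrightarrow> h (arm i j q t) \<in> W \<Longrightarrow> \<exists>t'. occupied T i j q t' \<and> x = h (arm i j q t')"
proof -
  define I where "I = (\<Union>i<length T. \<Union>j<length (T ! i). (\<lambda>q. (i, j, q)) ` ports (T ! i ! j))"
  define S where "S = (\<lambda>(i, j, q). h ` arm i j q ` {0..1})"
  have "finite (ports t)" for t by (cases t) auto
  then have fin: "finite I" by (auto simp: I_def)
  have comp: "closed (S u)" if u: "u \<in> I" for u
  proof -
    obtain i j q where ijq: "u = (i, j, q)" "i < length T" "j < length (T ! i)" "q \<in> ports (T ! i ! j)"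
      using u unfolding I_def by blast
    have "arm i j q ` {0..1} \<subseteq> rectangle T"
      by (intro image_subsetI arm_in_rectangle[OF rect]) (use ijq in \<open>simp add: occupied_def\<close>)
    moreover have "compact (arm i j q ` {0..1})"
      unfolding arm_def by (intro compact_continuous_image continuous_intros) simp
    ultimately have "compact (h ` arm i j q ` {0..1})"
      by (intro compact_continuous_image[OF continuous_on_subset[OF h_cont]])
    then show ?thesis unfolding S_def ijq by (simp add: compact_imp_closed)
  qed
  define W where "W = - (\<Union>u\<in>{u\<in>I. x \<notin> S u}. S u)"
  show thesis
  proof (rule that)
    show "open W" unfolding W_def using fin comp
      by (intro open_Compl closed_UN) auto
    show "x \<in> W" by (simp add: W_def)
    fix i j q t assume o: "occupied T i j q t" and W: "h (arm i j q t) \<in> W"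
    have u: "(i, j, q) \<in> I"
      using o unfolding I_def occupied_def by blast
    have "h (arm i j q t) \<in> S (i, j, q)"
      using o unfolding S_def occupied_def by auto
    then have "x \<in> S (i, j, q)"
      using W u unfolding W_def by blast
    then obtain t' where "t' \<in> {0..1}" "x = h (arm i j q t')"
      unfolding S_def by auto
    then show "\<exists>t'. occupied T i j q t' \<and> x = h (arm i j q t')"
      using o unfolding occupied_def by auto
  qed
qed

lemma paint_locally_constant:
  assumes m: "mosaic_labeling X up lo T m" and x: "x \<in> strands L \<inter> B"
  obtains W where "open W" "x \<in> W" "\<And>y. y \<in> strands L \<inter> B \<inter> W \<Longrightarrow> paint T m (g y) = paint T m (g x)"
proof -
  obtain W where W: "open W" "x \<in> W"
    "\<And>i j q t. occupied T i j q t \<Longrightarrow> h (arm i j q t) \<in> W \<Longrightarrow> \<exists>t'. occupied T i j q t' \<and> x = h (arm i j q t')"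
    using arm_neighbourhood by metis
  have paint_h: "paint T m (g (h (arm i j q t))) = m (end_of i j q)" if "on_strand T i j q t" for i j q t
    using that arm_in_rectangle[OF rect] paint_arm[OF m that] by (simp add: on_strand_def g_h)
  have "paint T m (g y) = paint T m (g x)" if y: "y \<in> strands L \<inter> B \<inter> W" for y
  proof -
    obtain i j q t where s: "on_strand T i j q t" "y = h (arm i j q t)"
      using y strand_iff by blast
    obtain t' where t': "occupied T i j q t'" "x = h (arm i j q t')"
      using W(3)[of i j q t] s y unfolding on_strand_def by blast
    have "on_strand T i j q t'"
    proof (rule ccontr)
      assume "\<not> ?thesis"
      then have "t' = 0" "T ! i ! j \<in> vertex_tiles"
        using t'(1) by (auto simp: on_strand_def occupied_def)
      then have "x \<in> vertices L \<inter> B"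
        unfolding vertices_iff using t' by (auto simp: arm_def occupied_def)
      with x show False by blast
    qed
    then show ?thesis using paint_h s t'(2) by simp
  qed
  with W show thesis using that by blast
qed

lemma strand_on_rim:
  assumes "x \<in> strands L \<inter> B" "x \<notin> h ` interior (rectangle T)"
  obtains e where "e \<in> ends T \<inter> rim T" "x = h (grid e)"
proof -
  obtain i j q t where s: "on_strand T i j q t" "x = h (arm i j q t)"
    using assms(1) strand_iff by blast
  then have "arm i j q t \<notin> interior (rectangle T)" using assms(2) by blast
  moreover have "occupied T i j q t" using s(1) by (simp add: on_strand_def)
  ultimately have "t = 1 \<and> end_of i j q \<in> ends T \<inter> rim T"
    by (intro arm_on_frontier[OF rect])
  then show thesis using that[of "end_of i j q"] s(2) by (simp add: grid_end_of)
qed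

text \<open>
  Here it matters that \<open>L\<close> is a diagram also at the frontier of \<open>B\<close>. Otherwise a neighbourhood of the
  rim end in the diagram would be part of a single arm and contain its end. But it is an open arc with
  the rim end as an interior point: the distance from the centre of the tile would be a continuous
  injective function on an open interval with an interior maximum.
\<close>
lemma rim_end_limit_of_outside:
  assumes marked: "marked_vertex_diagram L" and e: "e \<in> ends T \<inter> rim T"
  shows "h (grid e) islimpt (strands L - B)"
proof (rule ccontr)
  assume "\<not> ?thesis"
  then obtain N where N: "open N" "h (grid e) \<in> N" "\<And>y. y \<in> strands L - B \<Longrightarrow> y \<in> N \<Longrightarrow> y = h (grid e)"
    unfolding islimpt_def by blast
  define x where "x = h (grid e)"
  obtain i j q where ijq: "e = end_of i j q" "i < length T" "j < length (T ! i)" "q \<in> ports (T ! i ! j)"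
    using e unfolding ends_eq by blast
  have occ: "occupied T i j q 1" using ijq by (simp add: occupied_def)
  have x_arm: "x = h (arm i j q 1)" by (simp add: x_def ijq(1) grid_end_of)
  have x: "x \<in> strands L \<inter> B" using end_in_strands e by (simp add: x_def)
  obtain W where W: "open W" "x \<in> W"
    "\<And>i j q t. occupied T i j q t \<Longrightarrow> h (arm i j q t) \<in> W \<Longrightarrow> \<exists>t'. occupied T i j q t' \<and> x = h (arm i j q t')"
    using arm_neighbourhood by metis
  have near: "\<exists>t\<in>{0..1}. y = h (arm i j q t)" if y: "y \<in> strands L \<inter> N \<inter> W" for y
  proof -
    have "y \<in> B" using N(3)[of y] y x by (auto simp: x_def)
    then obtain i' j' q' t where s: "on_strand T i' j' q' t" "y = h (arm i' j' q' t)"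
      using y strand_iff by blast
    have o: "occupied T i' j' q' t" using s(1) by (simp add: on_strand_def)
    obtain t' where t': "occupied T i' j' q' t'" "x = h (arm i' j' q' t')"
      using W(3)[OF o] s(2) y by blast
    have "arm i j q 1 = arm i' j' q' t'"
      using arm_inj[OF occ t'(1)] x_arm t'(2) by simp
    moreover have "grid q \<in> directions" "grid q' \<in> directions"
      using occupied_direction[OF occ] occupied_direction[OF t'(1)] .
    ultimately have "t' = 1"
      using arm_unique[of q q' 1 t' i j i' j'] t'(1) by (fastforce simp: occupied_def)
    then have "end_of i j q = end_of i' j' q'"
      using \<open>arm i j q 1 = arm i' j' q' t'\<close> injD[OF inj_grid] by (simp add: grid_end_of[symmetric])
    moreover have "end_of i j q \<in> rim T" using e ijq(1) by simp
    ultimately have "i = i' \<and> j = j' \<and> q = q'"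
      using rim_end_unique[OF rect occ] t'(1) \<open>t' = 1\<close> by blast
    then show ?thesis using s(2) o by (auto simp: occupied_def)
  qed
  obtain k where k: "local_param L {1, -1} x k"
    using marked x unfolding marked_vertex_diagram_def by blast
  obtain U g' where U: "open U" "homeomorphism (ball 0 1) U k g'" "k 0 = x" "x \<in> U"
    using local_paramE[OF k] by metis
  have contk: "continuous_on (ball 0 1) k" and injk: "inj_on k (ball 0 1)"
    using U(2) by (auto simp: homeomorphism_def intro: inj_on_inverseI)
  have "open (k -` (N \<inter> W) \<inter> ball 0 1)"
    using continuous_open_preimage[OF contk open_ball, of "N \<inter> W"] N(1) W(1)
    by (simp add: Int_commute open_Int)
  moreover have "0 \<in> k -` (N \<inter> W) \<inter> ball 0 1"
    using U(3) N(2) W(2) by (simp add: x_def)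
  ultimately obtain \<epsilon> where \<epsilon>: "\<epsilon> > 0" "ball 0 \<epsilon> \<subseteq> k -` (N \<inter> W) \<inter> ball 0 1"
    by (rule openE) (rule that)
  define r where "r = \<epsilon> / 2"
  have r: "r > 0" "\<And>s. s \<in> {-r..r} \<Longrightarrow> complex_of_real s \<in> ball 0 \<epsilon>"
    using \<epsilon>(1) by (auto simp: r_def)
  have on_arm: "\<exists>t\<in>{0..1}. k (of_real s) = h (arm i j q t)" if s: "s \<in> {-r..r}" for s
  proof (rule near)
    have b: "complex_of_real s \<in> ball 0 1" "k (of_real s) \<in> N \<inter> W"
      using r(2)[OF s] \<epsilon>(2) by blast+
    have "k (of_real s) \<in> strands L"
    proof (cases "s = 0")
      case True
      then show ?thesis using U(3) x by simp
    next
      case False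
      have "of_real s \<in> star 0 {1, -1}"
        unfolding mem_star using b(1)
        by (cases "s > 0") (auto intro: bexI[of _ s] bexI[of _ "-s"])
      then show ?thesis
        using param_in_strands[OF k] b(1) False by simp
    qed
    then show "k (of_real s) \<in> strands L \<inter> N \<inter> W" using b by blast
  qed
  \<comment> \<open>Along the arm, the distance from the centre of the tile is the parameter.\<close>
  define \<phi> where "\<phi> s = cmod (g (k (of_real s)) - centre i j)" for s :: real
  have \<phi>_arm: "k (of_real s) = h (arm i j q (\<phi> s)) \<and> 0 \<le> \<phi> s \<and> \<phi> s \<le> 1" if s: "s \<in> {-r..r}" for s
  proof -
    obtain t where t: "t \<in> {0..1}" "k (of_real s) = h (arm i j q t)"
      using on_arm[OF s] by blast
    have "occupied T i j q t" using occ t by (simp add: occupied_def)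
    then have "g (k (of_real s)) = arm i j q t"
      using t(2) g_h arm_in_rectangle[OF rect] by simp
    then have "\<phi> s = t"
      using cmod_arm[OF port_direction[OF ijq(4)], of t] t(1) by (simp add: \<phi>_def arm_def)
    then show ?thesis using t by simp
  qed
  have "continuous_on {-r..r} \<phi>"
    unfolding \<phi>_def
  proof (intro continuous_intros continuous_on_compose2[OF g_cont])
    show "continuous_on {-r..r} (\<lambda>s. k (complex_of_real s))"
    proof (rule continuous_on_compose2[OF contk])
      show "complex_of_real ` {-r..r} \<subseteq> ball 0 1"
        using r(2) \<epsilon>(2) by blast
    qed (intro continuous_intros)
    show "(\<lambda>s. k (complex_of_real s)) ` {-r..r} \<subseteq> B"
    proof (rule image_subsetI)
      fix s assume s: "s \<in> {-r..r}"
      have "occupied T i j q (\<phi> s)" using occ \<phi>_arm[OF s] by (simp add: occupied_def)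
      then show "k (complex_of_real s) \<in> B"
        using \<phi>_arm[OF s] h_in_B arm_in_rectangle[OF rect] by simp
    qed
  qed
  moreover have "inj_on \<phi> {-r..r}"
  proof (rule inj_onI)
    fix s s' assume s: "s \<in> {-r..r}" "s' \<in> {-r..r}" "\<phi> s = \<phi> s'"
    have "k (of_real s) = k (of_real s')"
      using \<phi>_arm[OF s(1)] \<phi>_arm[OF s(2)] s(3) by simp
    moreover have "complex_of_real s \<in> ball 0 1" "complex_of_real s' \<in> ball 0 1"
      using r(2) s \<epsilon>(2) by blast+
    ultimately show "s = s'" using inj_onD[OF injk] of_real_eq_iff by metis
  qed
  ultimately have mono: "\<phi> (-r) < \<phi> 0 \<and> \<phi> 0 < \<phi> r \<or> \<phi> r < \<phi> 0 \<and> \<phi> 0 < \<phi> (-r)"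
    using continuous_inj_imp_mono[of "-r" 0 r \<phi>] r(1) by auto
  have "h (arm i j q (\<phi> 0)) = h (arm i j q 1)"
    using \<phi>_arm[of 0] r(1) U(3) x_arm by simp
  moreover have "occupied T i j q (\<phi> 0)" using occ \<phi>_arm[of 0] r(1) by (simp add: occupied_def)
  ultimately have "arm i j q (\<phi> 0) = arm i j q 1"
    using arm_inj occ by blast
  then have "\<phi> 0 = 1"
    using port_direction[OF ijq(4)] by (auto simp: arm_def mem_directions)
  then show False
    using mono \<phi>_arm[of r] \<phi>_arm[of "-r"] r(1) by auto
qed

end

section \<open>A single move\<close>

lemma mosaic_labeling_in_X:
  assumes "bikei X up lo" "mosaic_labeling X up lo T m" "e \<in> ends T"
  shows "m e \<in> X"
proof -
  obtain i j q where e: "e = end_of i j q" "i < length T" "j < length (T ! i)" "q \<in> ports (T ! i ! j)"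
    using assms(3) unfolding ends_eq by blast
  note rule = mosaic_labelingD[OF assms(2) e(2,3)]
  show ?thesis
    using rule e(4) bikei.up_closed[OF assms(1)] bikei.lo_closed[OF assms(1)] unfolding e(1)
    by (cases "T ! i ! j") (auto simp: crossing_labels_def)
qed

locale local_move =
  fixes T T' :: mosaic and B :: "complex set" and h g :: "complex \<Rightarrow> complex" and L L' :: diagram
    and X :: "'a set" and up lo :: "'a \<Rightarrow> 'a \<Rightarrow> 'a"
  assumes bikei: "bikei X up lo" and move: "yoshikawa T T'"
    and homeo: "homeomorphism (rectangle T) B h g"
    and depicts: "depicts h T L" "depicts h T' L'" and outside: "same_outside B L L'"
    and marked: "marked_vertex_diagram L" "marked_vertex_diagram L'"
begin

lemma matched: "well_matched T T'" and exchangeable: "exchangeable X up lo T T'"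
  using yoshikawa_exchangeable[OF move bikei] by blast+

lemma rectangle_eq: "rectangle T' = rectangle T"
  using matched by (simp add: well_matched_def rectangle_def)

sublocale old: depicted T B h g L
  by unfold_locales (use matched homeo depicts in \<open>simp_all add: well_matched_def\<close>)

sublocale new: depicted T' B h g L'
  by unfold_locales (use matched homeo depicts rectangle_eq in \<open>simp_all add: well_matched_def\<close>)

lemma vertices_outside: "vertices L - B = vertices L' - B"
  using outside by (auto simp: same_outside_def vertices_def)

lemma strands_outside: "strands L - B = strands L' - B"
  using outside vertices_outside by (auto simp: same_outside_def)

lemma rim_ends: "ends T \<inter> rim T = ends T' \<inter> rim T'"
  using matched by (simp add: well_matched_def)

lemma rim_eq: "rim T = rim T'"
  using matched by (simp add: well_matched_def rim_def)

text \<open>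
  The labels at the rim are limits of labels outside the disk.
\<close>
lemma labels_on_rim:
  assumes "locally_constant (strands L') G'" "locally_constant (strands L') G''"
    and eq: "\<And>p. p \<in> strands L' - B \<Longrightarrow> G' p = G'' p" and e: "e \<in> ends T' \<inter> rim T'"
  shows "G' (h (grid e)) = G'' (h (grid e))"
proof -
  let ?x = "h (grid e)"
  have x: "?x \<in> strands L'" using new.end_in_strands e by blast
  have "\<forall>\<^sub>F y in at ?x within strands L' - B. G' y = G' ?x"
    using assms(1) x by (auto simp: locally_constant_def intro: filter_leD[OF at_le[OF Diff_subset]])
  moreover have "\<forall>\<^sub>F y in at ?x within strands L' - B. G'' y = G'' ?x"
    using assms(2) x by (auto simp: locally_constant_def intro: filter_leD[OF at_le[OF Diff_subset]])
  moreover have "\<forall>\<^sub>F y in at ?x within strands L' - B. y \<in> strands L' - B"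
    by (simp add: eventually_at_filter)
  ultimately have "\<forall>\<^sub>F y in at ?x within strands L' - B. G' ?x = G'' ?x"
    by eventually_elim (use eq in auto)
  moreover have "at ?x within (strands L' - B) \<noteq> bot"
    using new.rim_end_limit_of_outside[OF marked(2) e] by (simp add: trivial_limit_within)
  ultimately show ?thesis by simp
qed

text \<open>
  Labels outside the disk determine those at the rim, and these determine the labels on all of the
  mosaic.
\<close>
theorem labeling_unique:
  assumes G': "point_labeling X up lo L' G'" and G'': "point_labeling X up lo L' G''"
    and eq: "\<And>p. p \<in> strands L' - B \<Longrightarrow> G' p = G'' p" and p: "p \<in> strands L'"
  shows "G' p = G'' p"
proof (cases "p \<in> B")
  case True
  then obtain i j q t where s: "on_strand T' i j q t" "p = h (arm i j q t)"
    using p new.strand_iff by blast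
  have lc: "locally_constant (strands L') G'" "locally_constant (strands L') G''"
    using G' G'' by (auto simp: point_labeling_def)
  have "\<forall>e\<in>ends T'. G' (h (grid e)) = G'' (h (grid e))"
    using exchangeable labels_on_rim[OF lc eq]
      new.mosaic_labeling_of_point_labeling[OF bikei G'] new.mosaic_labeling_of_point_labeling[OF bikei G'']
    unfolding exchangeable_def rim_determines_def by blast
  moreover have "end_of i j q \<in> ends T'"
    using on_strandD[OF s(1)] unfolding ends_eq by blast
  ultimately show ?thesis
    unfolding s(2) new.constant_on_arm[OF lc(1) s(1)] new.constant_on_arm[OF lc(2) s(1)] by blast
qed (use eq p in blast)

text \<open>
  The labels inside the disk are replaced by those that the combinatorial theorem provides. The result
  is locally constant across the frontier because both mosaics have the same labels at the rim. At
  vertices, one parametrization suffices: the one by \<open>h\<close> inside the disk, and any one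
  for the old diagram outside of it.
\<close>
theorem labeling_exists:
  assumes G: "point_labeling X up lo L G"
  obtains G' where "point_labeling X up lo L' G'" "\<And>p. p \<in> strands L - B \<Longrightarrow> G' p = G p"
proof -
  note G_rules = G[unfolded point_labeling_def]
  note G_X = G_rules[THEN conjunct1] and G_lc = G_rules[THEN conjunct2, THEN conjunct1]
    and G_crossing = G_rules[THEN conjunct2, THEN conjunct2, THEN conjunct1]
    and G_saddle = G_rules[THEN conjunct2, THEN conjunct2, THEN conjunct2]
  obtain m where m: "mosaic_labeling X up lo T' m" "\<And>e. e \<in> rim T \<Longrightarrow> m e = G (h (grid e))"
    using exchangeable old.mosaic_labeling_of_point_labeling[OF bikei G]
    unfolding exchangeable_def extends_def by blast
  define G' where "G' x = (if x \<in> B then paint T' m (g x) else G x)" for x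
  have G'_arm: "G' (h (arm i j q t)) = m (end_of i j q)" if s: "on_strand T' i j q t" for i j q t
  proof -
    have "arm i j q t \<in> rectangle T'"
      by (rule arm_in_rectangle[OF new.rect]) (use s in \<open>simp add: on_strand_def\<close>)
    then show ?thesis
      using paint_arm[OF m(1) s] new.h_in_B new.g_h by (simp add: G'_def)
  qed
  \<comment> \<open>At the rim the old and the new mosaic carry the same labels, so the old labels outside fit.\<close>
  have G'_rim: "G' x = G x" "x \<in> strands L" if x: "x \<in> strands L' \<inter> B" "x \<notin> h ` interior (rectangle T')" for x
  proof -
    obtain e where e: "e \<in> ends T' \<inter> rim T'" "x = h (grid e)"
      using new.strand_on_rim[OF x] by blast
    then obtain i j q where ijq: "e = end_of i j q" "on_strand T' i j q 1"
      unfolding ends_eq on_strand_def occupied_def by auto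
    have "G' x = m e" using G'_arm[OF ijq(2)] e(2) by (simp add: ijq(1) grid_end_of)
    also have "\<dots> = G x" using m(2) e rim_eq by simp
    finally show "G' x = G x" .
    show "x \<in> strands L" using old.end_in_strands e rim_ends by blast
  qed
  have G'_X: "G' p \<in> X" if p: "p \<in> strands L'" for p
  proof (cases "p \<in> B")
    case True
    then obtain i j q t where s: "on_strand T' i j q t" "p = h (arm i j q t)"
      using p new.strand_iff by blast
    have "end_of i j q \<in> ends T'"
      using on_strandD[OF s(1)] unfolding ends_eq by blast
    then show ?thesis
      using G'_arm[OF s(1)] s(2) mosaic_labeling_in_X[OF bikei m(1)] by simp
  next
    case False
    then have "p \<in> strands L" using p strands_outside by blast
    then show ?thesis using False G_X by (auto simp: G'_def)
  qed
  have G'_lc: "locally_constant (strands L') G'"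
    unfolding locally_constant_def
  proof
    fix p assume p: "p \<in> strands L'"
    \<comment> \<open>Local constancy is checked separately for approach from inside and from outside the disk.\<close>
    have split: "at p within strands L' = sup (at p within strands L' \<inter> B) (at p within strands L' - B)"
      unfolding at_within_union[symmetric] by (simp add: Int_Diff_Un)
    have inside: "\<forall>\<^sub>F x in at p within strands L' \<inter> B. G' x = G' p"
    proof (cases "p \<in> B")
      case True
      then obtain W where W: "open W" "p \<in> W"
        "\<And>x. x \<in> strands L' \<inter> B \<inter> W \<Longrightarrow> paint T' m (g x) = paint T' m (g p)"
        using new.paint_locally_constant[OF m(1)] p by blast
      then show ?thesis
        unfolding eventually_at_topological using True by (auto simp: G'_def)
    next
      case False
      have "open (- B)" using old.compact_B by (simp add: compact_imp_closed open_Compl)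
      then show ?thesis
        unfolding eventually_at_topological using False by blast
    qed
    have outside_B: "\<forall>\<^sub>F x in at p within strands L' - B. G' x = G' p"
    proof (cases "p \<in> h ` interior (rectangle T')")
      case True
      have "open (h ` interior (rectangle T'))" "h ` interior (rectangle T') \<subseteq> B"
        using new.open_image[OF open_interior interior_subset] new.h_image interior_subset by blast+
      then show ?thesis
        unfolding eventually_at_topological using True by blast
    next
      case False
      have p': "G' p = G p \<and> p \<in> strands L"
      proof (cases "p \<in> B")
        case True
        then show ?thesis using G'_rim[OF _ False] p by blast
      next
        case False
        then show ?thesis using p strands_outside by (auto simp: G'_def)
      qed
      have "\<forall>\<^sub>F x in at p within strands L - B. G x = G p"
        using G_lc p' by (auto simp: locally_constant_def intro: filter_leD[OF at_le[OF Diff_subset]])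
      then show ?thesis
        unfolding strands_outside[symmetric] using p'
        by (auto simp: eventually_at_filter G'_def elim: eventually_mono)
    qed
    show "\<forall>\<^sub>F x in at p within strands L'. G' x = G' p"
      unfolding split eventually_sup using inside outside_B by blast
  qed
  have B_closed: "open (- B)" using old.compact_B by (simp add: compact_imp_closed open_Compl)
  have same_points: "points L \<inter> - B = points L' \<inter> - B"
    using outside by (auto simp: same_outside_def)
  have G_G': "G p = G' p" if "p \<in> strands L \<inter> - B" for p
    using that by (simp add: G'_def)
  have half: "G' (h (arm i j q (1/2))) = m (end_of i j q)"
    if "i < length T'" "j < length (T' ! i)" "q \<in> ports (T' ! i ! j)" for i j q
    by (rule G'_arm) (use that in \<open>simp add: on_strand_def occupied_def\<close>)
  have "point_labeling X up lo L' G'"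
    unfolding point_labeling_def
  proof (intro conjI ballI allI impI)
    show "G' ` strands L' \<subseteq> X" using G'_X by blast
    show "locally_constant (strands L') G'" by (rule G'_lc)
  next
    fix v k assume v: "v \<in> crossings L'" "crossing_param L' v k"
    show "crossing_labels X up lo (G' (k (\<i> / 2))) (G' (k (- \<i> / 2))) (G' (k (1 / 2))) (G' (k (- 1 / 2)))"
    proof (cases "v \<in> B")
      case True
      then obtain i j a where c: "i < length T'" "j < length (T' ! i)" "v = h (centre i j)"
        "crossing_param L' v (\<lambda>z. h (centre i j + a * z))"
        "T' ! i ! j = XH \<and> a = 1 \<or> T' ! i ! j = XV \<and> a = \<i>"
        using new.crossing_param_tile[of v] v(1) by blast
      note rule = mosaic_labelingD[OF m(1) c(1,2)] and half = half[OF c(1,2)]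
      have "crossing_labels X up lo (G' (h (centre i j + a * (\<i> / 2)))) (G' (h (centre i j + a * (- \<i> / 2))))
        (G' (h (centre i j + a * (1 / 2)))) (G' (h (centre i j + a * (- 1 / 2))))"
        using c(5)
      proof
        assume "T' ! i ! j = XH \<and> a = 1"
        then show ?thesis
          using rule bikei.crossing_labels_flip_over[OF bikei] by (simp add: new.half_arm half)
      next
        assume "T' ! i ! j = XV \<and> a = \<i>"
        then show ?thesis
          using rule by (simp add: new.half_arm half)
      qed
      then show ?thesis
        by (rule crossing_labels_param[OF bikei c(4) v(2) open_UNIV _ _ _ G'_lc G'_lc, rotated -1]) simp_all
    next
      case False
      then have vL: "v \<in> crossings L" "over L v = over L' v"
        using v(1) outside unfolding same_outside_def by blast+
      then obtain k0 where k0: "crossing_param L v k0"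
        using marked(1) unfolding marked_vertex_diagram_def by blast
      show ?thesis
        by (rule crossing_labels_param[OF bikei k0 v(2) B_closed _ same_points vL(2) G_lc G'_lc G_G'])
          (use False G_crossing vL k0 in auto)
    qed
  next
    fix v k and d d' :: complex
    assume v: "v \<in> saddles L'" "saddle_param L' v k" and d: "d \<in> directions" "d' \<in> directions"
    show "G' (k (d / 2)) = G' (k (d' / 2))"
    proof (cases "v \<in> B")
      case True
      then obtain i j a where c: "i < length T'" "j < length (T' ! i)" "v = h (centre i j)"
        "saddle_param L' v (\<lambda>z. h (centre i j + a * z))"
        "T' ! i ! j = ME \<and> a = 1 \<or> T' ! i ! j = MW \<and> a = \<i>"
        using new.saddle_param_tile[of v] v(1) by blast
      note rule = mosaic_labelingD[OF m(1) c(1,2)] and half = half[OF c(1,2)]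
      have all: "G' (h (centre i j + a * (e / 2))) = m (end_of i j north)" if "e \<in> directions" for e
        using c(5) rule that by (auto simp: mem_directions new.half_arm half)
      show ?thesis
      proof (rule saddle_labels_param[OF c(4) v(2) open_UNIV _ _ G'_lc G'_lc _ _ d])
        fix e e' assume "e \<in> directions" "e' \<in> directions"
        then show "G' (h (centre i j + a * (e / 2))) = G' (h (centre i j + a * (e' / 2)))"
          by (simp only: all)
      qed simp_all
    next
      case False
      then have vL: "v \<in> saddles L"
        using v(1) outside unfolding same_outside_def by blast
      then obtain k0 where k0: "saddle_param L v k0"
        using marked(1) unfolding marked_vertex_diagram_def by blast
      show ?thesis
      proof (rule saddle_labels_param[OF k0 v(2) B_closed _ same_points G_lc G'_lc G_G' _ d])
        show "v \<in> - B" using False by simp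
        show "G (k0 (e / 2)) = G (k0 (e' / 2))" if "e \<in> directions" "e' \<in> directions" for e e'
          by (rule G_saddle[rule_format, OF vL k0 that])
      qed
    qed
  qed
  then show thesis
    using that by (simp add: G'_def)
qed

end

lemma move_step:
  assumes "bikei X up lo" "yoshikawa_move B L L'" "marked_vertex_diagram L" "marked_vertex_diagram L'"
    and f: "labeling X up lo L f"
  shows "\<exists>!f'. labeling X up lo L' f' \<and> labels_agree (Move B) L f L' f'"
proof -
  obtain T T' h g where "local_move T T' B h g L L' X up lo"
    using assms unfolding yoshikawa_move_def local_move_def by blast
  then interpret local_move T T' B h g L L' X up lo .
  obtain G' where G': "point_labeling X up lo L' G'" "\<And>p. p \<in> strands L - B \<Longrightarrow> G' p = label L f p"
    using labeling_exists[OF labeling_point_labeling[OF assms(3) f]] by blast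
  obtain f' where f': "labeling X up lo L' f'" "\<And>p. p \<in> strands L' \<Longrightarrow> label L' f' p = G' p"
    using point_labeling_labeling[OF assms(1) G'(1)] by blast
  show ?thesis
  proof (rule ex1I[of _ f'])
    show "labeling X up lo L' f' \<and> labels_agree (Move B) L f L' f'"
      using f' G'(2) strands_outside by auto
  next
    fix f'' assume f'': "labeling X up lo L' f'' \<and> labels_agree (Move B) L f L' f''"
    have "label L' f'' p = label L' f' p" if "p \<in> strands L'" for p
    proof (rule labeling_unique[OF _ _ _ that])
      show "point_labeling X up lo L' (label L' f'')" "point_labeling X up lo L' (label L' f')"
        using f'' f'(1) labeling_point_labeling[OF assms(4)] by blast+
      fix p assume "p \<in> strands L' - B"
      then show "label L' f'' p = label L' f' p"
        using f'' f'(2) G'(2) strands_outside by auto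
    qed
    then show "f'' = f'"
      using labeling_ext f'' f'(1) by blast
  qed
qed

section \<open>Planar isotopies\<close>

text \<open>
  Parametrizations of the moved diagram are transported back to the old diagram; this direction is what
  the labeling condition for all parametrizations of the new diagram needs.
\<close>
lemma moved_local_param:
  assumes \<phi>: "homeomorphism UNIV UNIV \<phi> \<psi>" and moved: "moved_by \<phi> L L'" and k: "local_param L' A v k"
  shows "local_param L A (\<psi> v) (\<psi> \<circ> k)"
proof -
  have inv: "\<psi> (\<phi> x) = x" "\<phi> (\<psi> x) = x" for x
    using \<phi> by (auto simp: homeomorphism_def)
  have cont: "continuous_on S \<phi>" "continuous_on S \<psi>" for S
    using \<phi> continuous_on_subset[of UNIV] by (auto simp: homeomorphism_def)
  obtain U g where U: "open U" "homeomorphism (ball 0 1) U k g" "k 0 = v"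
      "points L' \<inter> U = k ` (star 0 A \<inter> ball 0 1)" "vertices L' \<inter> U \<subseteq> {v}"
    using k unfolding local_param_def by blast
  have \<psi>_image: "\<psi> ` S = \<phi> -` S" for S
  proof (intro equalityI subsetI)
    fix x assume "x \<in> \<phi> -` S"
    then show "x \<in> \<psi> ` S" by (intro rev_image_eqI[of "\<phi> x"]) (simp_all add: inv)
  qed (auto simp: inv)
  have "open (\<psi> ` U)"
    unfolding \<psi>_image using cont(1)[of UNIV] U(1) by (simp add: open_vimage)
  moreover have "homeomorphism (ball 0 1) (\<psi> ` U) (\<psi> \<circ> k) (g \<circ> \<phi>)"
    by (rule homeomorphism_compose[OF U(2)])
      (use inv cont in \<open>auto simp: homeomorphism_def image_image\<close>)
  moreover have "points L = \<psi> ` points L'" "vertices L = \<psi> ` vertices L'"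
    using moved inv by (auto simp: moved_by_def vertices_def image_image image_Un)
  then have "points L \<inter> \<psi> ` U = (\<psi> \<circ> k) ` (star 0 A \<inter> ball 0 1)" "vertices L \<inter> \<psi> ` U \<subseteq> {\<psi> v}"
    using U(4,5) unfolding image_comp[symmetric] U(4)[symmetric]
    by (auto simp: \<psi>_image inv)
  ultimately show ?thesis
    unfolding local_param_def using U(3) by (intro exI conjI) auto
qed

text \<open>
  Composition with the inverse homeomorphism carries labels along.
\<close>
lemma isotopy_step:
  assumes "bikei X up lo" "planar_isotopy \<phi>" and moved: "moved_by \<phi> L L'"
    and marked: "marked_vertex_diagram L" "marked_vertex_diagram L'"
    and f: "labeling X up lo L f"
  shows "\<exists>!f'. labeling X up lo L' f' \<and> labels_agree (Isotopy \<phi>) L f L' f'"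
proof -
  obtain \<psi> where \<phi>: "homeomorphism UNIV UNIV \<phi> \<psi>"
    using assms(2) unfolding planar_isotopy_def by (metis atLeastAtMost_iff order_refl zero_le_one)
  have inv: "\<psi> (\<phi> x) = x" "\<phi> (\<psi> x) = x" for x
    using \<phi> by (auto simp: homeomorphism_def)
  have strands: "strands L' = \<phi> ` strands L"
  proof -
    have "inj \<phi>" using inv by (metis injI)
    then show ?thesis
      using moved by (simp add: moved_by_def vertices_def image_Un[symmetric] image_set_diff)
  qed
  define G where "G = label L f"
  note G_rules = labeling_point_labeling[OF marked(1) f, folded G_def, unfolded point_labeling_def]
  note G_lc = G_rules[THEN conjunct2, THEN conjunct1]
    and G_crossing = G_rules[THEN conjunct2, THEN conjunct2, THEN conjunct1]
    and G_saddle = G_rules[THEN conjunct2, THEN conjunct2, THEN conjunct2]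
  have "point_labeling X up lo L' (G \<circ> \<psi>)"
    unfolding point_labeling_def
  proof (intro conjI ballI allI impI)
    show "(G \<circ> \<psi>) ` strands L' \<subseteq> X"
      using G_rules by (auto simp: strands inv)
    show "locally_constant (strands L') (G \<circ> \<psi>)"
      unfolding locally_constant_def
    proof
      fix p assume p: "p \<in> strands L'"
      have "\<psi> p \<in> strands L" using p unfolding strands by (auto simp only: inv)
      then have "\<forall>\<^sub>F q in at (\<psi> p) within strands L. G q = G (\<psi> p)"
        using G_lc by (rule locally_constant_def[THEN iffD1, rule_format, rotated])
      then obtain S where S: "open S" "\<psi> p \<in> S" "\<forall>q\<in>S. q \<noteq> \<psi> p \<longrightarrow> q \<in> strands L \<longrightarrow> G q = G (\<psi> p)"
        unfolding eventually_at_topological by blast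
      have "open (\<psi> -` S)"
        using \<phi> S(1) by (simp add: homeomorphism_def open_vimage)
      moreover have "p \<in> \<psi> -` S" using S(2) by simp
      moreover have "(G \<circ> \<psi>) q = (G \<circ> \<psi>) p" if "q \<in> \<psi> -` S" "q \<in> strands L'" for q
      proof -
        have "\<psi> q \<in> strands L" using that(2) unfolding strands by (auto simp only: inv)
        then show ?thesis using S(3) that(1) by (cases "\<psi> q = \<psi> p") auto
      qed
      ultimately show "\<forall>\<^sub>F q in at p within strands L'. (G \<circ> \<psi>) q = (G \<circ> \<psi>) p"
        unfolding eventually_at_topological by blast
    qed
  next
    fix v k assume v: "v \<in> crossings L'" "crossing_param L' v k"
    have w: "\<psi> v \<in> crossings L" "over L' v = filtermap \<phi> (over L (\<psi> v))"
      using moved v(1) by (auto simp: moved_by_def inv)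
    then have "over L (\<psi> v) = filtermap \<psi> (over L' v)"
      by (simp add: filtermap_filtermap inv filtermap_ident)
    then have "crossing_param L (\<psi> v) (\<psi> \<circ> k)"
      using v(2) moved_local_param[OF \<phi> moved, of _ v k]
      by (simp add: crossing_param_def filtermap_filtermap o_def)
    from G_crossing[rule_format, OF w(1) this]
    show "crossing_labels X up lo ((G \<circ> \<psi>) (k (\<i> / 2))) ((G \<circ> \<psi>) (k (- \<i> / 2)))
      ((G \<circ> \<psi>) (k (1 / 2))) ((G \<circ> \<psi>) (k (- 1 / 2)))" by simp
  next
    fix v k and d d' :: complex
    assume v: "v \<in> saddles L'" "saddle_param L' v k" and d: "d \<in> directions" "d' \<in> directions"
    have w: "\<psi> v \<in> saddles L" "below L' v = filtermap \<phi> ` below L (\<psi> v)"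
      using moved v(1) by (auto simp: moved_by_def inv)
    then have "below L (\<psi> v) = filtermap \<psi> ` below L' v"
      by (simp add: image_image filtermap_filtermap inv filtermap_ident)
    then have "saddle_param L (\<psi> v) (\<psi> \<circ> k)"
      using v(2) moved_local_param[OF \<phi> moved, of _ v k]
      by (simp add: saddle_param_def filtermap_filtermap o_def)
    from G_saddle[rule_format, OF w(1) this d]
    show "(G \<circ> \<psi>) (k (d / 2)) = (G \<circ> \<psi>) (k (d' / 2))" by simp
  qed
  then obtain f' where f': "labeling X up lo L' f'" "\<And>p. p \<in> strands L' \<Longrightarrow> label L' f' p = G (\<psi> p)"
    using point_labeling_labeling[OF assms(1)] by (metis comp_apply)
  have agree: "labels_agree (Isotopy \<phi>) L f L' f'' \<longleftrightarrow> (\<forall>p\<in>strands L'. label L' f'' p = G (\<psi> p))" for f''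
    by (simp add: strands inv G_def)
  show ?thesis
    unfolding agree
  proof (rule ex1I[of _ f'])
    fix f'' assume f'': "labeling X up lo L' f'' \<and> (\<forall>p\<in>strands L'. label L' f'' p = G (\<psi> p))"
    then show "f'' = f'"
      using f' by (intro labeling_ext[of X up lo L']) simp_all
  qed (use f' in blast)
qed

section \<open>Sequences of moves\<close>

text \<open>
  Uniqueness is claimed for the last element instead of \<open>F\<close>, whose values beyond \<open>n\<close> are arbitrary.
\<close>
lemma unique_chain:
  fixes P :: "nat \<Rightarrow> 'b \<Rightarrow> bool" and R :: "nat \<Rightarrow> 'b \<Rightarrow> 'b \<Rightarrow> bool"
  assumes "P 0 x" and step: "\<And>i y. i < n \<Longrightarrow> P i y \<Longrightarrow> \<exists>!z. P (Suc i) z \<and> R i y z"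
  shows "\<exists>!z. \<exists>F. F 0 = x \<and> F n = z \<and> (\<forall>i\<le>n. P i (F i)) \<and> (\<forall>i<n. R i (F i) (F (Suc i)))"
  using step
proof (induction n)
  case 0
  show ?case
    by (rule ex1I[of _ x]) (use assms(1) in \<open>auto intro: exI[of _ "\<lambda>_. x"]\<close>)
next
  case (Suc n)
  let ?C = "\<lambda>n z F. F 0 = x \<and> F n = z \<and> (\<forall>i\<le>n. P i (F i)) \<and> (\<forall>i<n. R i (F i) (F (Suc i)))"
  have "\<exists>!z. \<exists>F. ?C n z F"
    by (rule Suc.IH) (use Suc.prems in simp)
  then obtain y where ex: "\<exists>F. ?C n y F" and unique: "\<forall>z. (\<exists>F. ?C n z F) \<longrightarrow> z = y"
    by (rule ex1E)
  then obtain F where F: "?C n y F"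
    by (elim exE)
  obtain z where z: "P (Suc n) z" "R n y z" "\<And>z'. P (Suc n) z' \<Longrightarrow> R n y z' \<Longrightarrow> z' = z"
    using Suc.prems[of n y] F by blast
  show ?case
  proof (rule ex1I[of _ z])
    let ?F = "F(Suc n := z)"
    have "P i (?F i)" if "i \<le> Suc n" for i
      using F z(1) that by (cases "i = Suc n") simp_all
    moreover have "R i (?F i) (?F (Suc i))" if "i < Suc n" for i
      using F z(2) that by (cases "i = n") simp_all
    moreover have "?F 0 = x" "?F (Suc n) = z"
      using F by simp_all
    ultimately show "\<exists>F. ?C (Suc n) z F"
      by blast
  next
    fix z' assume "\<exists>F. ?C (Suc n) z' F"
    then obtain F' where F': "?C (Suc n) z' F'" by blast
    then have "?C n (F' n) F'" by simp
    then have "F' n = y" by (intro unique[rule_format] exI)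
    moreover have "P (Suc n) (F' (Suc n))" "R n (F' n) (F' (Suc n))" "F' (Suc n) = z'"
      using F' by (blast intro: le_refl lessI)+
    ultimately show "z' = z" using z(3) by metis
  qed
qed

theorem theorem1:
  fixes X :: "'a set" and up lo :: "'a \<Rightarrow> 'a \<Rightarrow> 'a"
    and L L' :: diagram and D :: "nat \<Rightarrow> diagram" and s :: "nat \<Rightarrow> step" and n :: nat
    and f :: "complex set \<Rightarrow> 'a"
  assumes "bikei X up lo"
    and "marked_vertex_diagram L" and "marked_vertex_diagram L'"
    and "yoshikawa_sequence n D s L L'"
    and "labeling X up lo L f"
  shows "\<exists>!f'. labeling X up lo L' f' \<and> corresponds X up lo n D s f f'"
proof -
  have D: "D 0 = L" "D n = L'" "\<And>i. i \<le> n \<Longrightarrow> marked_vertex_diagram (D i)"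
    "\<And>i. i < n \<Longrightarrow> is_step (s i) (D i) (D (Suc i))"
    using assms(4) by (auto simp: yoshikawa_sequence_def)
  have "\<exists>!f'. labeling X up lo (D (Suc i)) f' \<and> labels_agree (s i) (D i) f (D (Suc i)) f'"
    if "i < n" "labeling X up lo (D i) f" for i f
  proof (cases "s i")
    case (Move B)
    then have "yoshikawa_move B (D i) (D (Suc i))" using D(4)[OF that(1)] by simp
    then show ?thesis
      unfolding Move by (rule move_step[OF assms(1)]) (use D(3) that in simp_all)
  next
    case (Isotopy \<phi>)
    then have "planar_isotopy \<phi>" "moved_by \<phi> (D i) (D (Suc i))" using D(4)[OF that(1)] by simp_all
    then show ?thesis
      unfolding Isotopy by (rule isotopy_step[OF assms(1)]) (use D(3) that in simp_all)
  qed
  then have "\<exists>!f'. corresponds X up lo n D s f f'"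
    unfolding corresponds_def
    by (intro unique_chain[where P = "\<lambda>i. labeling X up lo (D i)"]) (use assms(5) D(1) in simp_all)
  moreover have "labeling X up lo L' f'" if "corresponds X up lo n D s f f'" for f'
    using that D(2) by (auto simp: corresponds_def)
  ultimately show ?thesis by blast
qed

end
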